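(* Let $d\ge1$ and let $g$ be a rigid Carmichael polynomial of order $d$ in $\mathbb{F}_q[t]$. Then $g$ is Carmichael in every finite separable extension $K$ of $\mathbb{F}_q(t)$ of degree $d$ whose discriminant is relatively prime to $g$.
   Context: $\mathbb{F}_q$ is the finite field with $q$ elements. A rigid Carmichael polynomial of order $d$ in $\mathbb{F}_q[t]$ is a reducible square-free polynomial $g$ such that $i\cdot\deg P$ divides $d\cdot\deg g$ for every irreducible polynomial $P$ dividing $g$ and every $i=1,\dots,d$. A finite ring $S$ is a Carmichael ring if $S$ is not a field and $a^{|S|}=a$ for every $a\in S$; an ideal $I$ of a ring $R$ is a Carmichael ideal if $R/I$ is a Carmichael ring. For a finite extension $K$ of $\mathbb{F}_q(t)$, $\mathcal{O}_K$ denotes the integral closure of $\mathbb{F}_q[t]$ in $K$, and an element $\alpha\in\mathcal{O}_K$ is Carmichael in $K$ if $\alpha\mathcal{O}_K$ is a Carmichael ideal of $\mathcal{O}_K$. The discriminant of $K$ is the discriminant ideal of $\mathcal{O}_K$ over $\mathbb{F}_q[t]$; "relatively prime to $g$" means no irreducible factor of $g$ divides it. *)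

theory Defs
  imports "HOL-Computational_Algebra.Computational_Algebra"
          "Jordan_Normal_Form.Determinant"
begin

definition reducible_poly :: "'a::field poly \<Rightarrow> bool" where
  "reducible_poly g \<longleftrightarrow> g \<noteq> 0 \<and> \<not> is_unit g \<and> \<not> irreducible g"

definition rigid_carmichael_poly :: "nat \<Rightarrow> 'a::{finite,field} poly \<Rightarrow> bool" where
  "rigid_carmichael_poly d g \<longleftrightarrow>
     reducible_poly g \<and> squarefree g \<and>
     (\<forall>P i. irreducible P \<and> P dvd g \<and> 1 \<le> i \<and> i \<le> d
            \<longrightarrow> (i * degree P) dvd (d * degree g))"

definition cosets :: "'k::comm_ring_1 set \<Rightarrow> 'k set \<Rightarrow> 'k set set" where
  "cosets R I = (\<lambda>x. {x + i | i. i \<in> I}) ` R"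

definition quot_is_field :: "'k::comm_ring_1 set \<Rightarrow> 'k set \<Rightarrow> bool" where
  "quot_is_field R I \<longleftrightarrow> 1 \<notin> I \<and> (\<forall>a\<in>R. a \<notin> I \<longrightarrow> (\<exists>b\<in>R. a * b - 1 \<in> I))"

definition carmichael_quot :: "'k::comm_ring_1 set \<Rightarrow> 'k set \<Rightarrow> bool" where
  "carmichael_quot R I \<longleftrightarrow>
     finite (cosets R I) \<and> \<not> quot_is_field R I \<and>
     (\<forall>a\<in>R. a ^ card (cosets R I) - a \<in> I)"

section \<open>Finite extensions K of F_q(t), given by a field embedding psi : F_q(t) -> K\<close>

definition embed :: "'a::idom \<Rightarrow> 'a fract" where
  "embed p = Fract p 1"

definition is_field_hom :: "('f::field \<Rightarrow> 'k::field) \<Rightarrow> bool" where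
  "is_field_hom \<psi> \<longleftrightarrow> \<psi> 1 = 1 \<and> (\<forall>x y. \<psi> (x + y) = \<psi> x + \<psi> y) \<and> (\<forall>x y. \<psi> (x * y) = \<psi> x * \<psi> y)"

definition is_basis :: "('f::field \<Rightarrow> 'k::field) \<Rightarrow> nat \<Rightarrow> (nat \<Rightarrow> 'k) \<Rightarrow> bool" where
  "is_basis \<psi> d b \<longleftrightarrow>
     (\<forall>y. \<exists>!c. (\<forall>i\<ge>d. c i = 0) \<and> y = (\<Sum>i<d. \<psi> (c i) * b i))"

definition ext_degree :: "('f::field \<Rightarrow> 'k::field) \<Rightarrow> nat \<Rightarrow> bool" where
  "ext_degree \<psi> d \<longleftrightarrow> (\<exists>b. is_basis \<psi> d b)"

definition separable_ext :: "('f::field \<Rightarrow> 'k::field) \<Rightarrow> bool" where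
  "separable_ext \<psi> \<longleftrightarrow>
     (\<forall>x. \<exists>f. f \<noteq> 0 \<and> coprime f (pderiv f) \<and> poly (map_poly \<psi> f) x = 0)"

definition coord :: "('f::field \<Rightarrow> 'k::field) \<Rightarrow> nat \<Rightarrow> (nat \<Rightarrow> 'k) \<Rightarrow> 'k \<Rightarrow> nat \<Rightarrow> 'f" where
  "coord \<psi> d b y = (THE c. (\<forall>i\<ge>d. c i = 0) \<and> y = (\<Sum>i<d. \<psi> (c i) * b i))"

definition ext_trace :: "('f::field \<Rightarrow> 'k::field) \<Rightarrow> nat \<Rightarrow> 'k \<Rightarrow> 'f" where
  "ext_trace \<psi> d x = (let b = (SOME b. is_basis \<psi> d b) in (\<Sum>i<d. coord \<psi> d b (x * b i) i))"

definition ext_disc :: "('f::field \<Rightarrow> 'k::field) \<Rightarrow> nat \<Rightarrow> (nat \<Rightarrow> 'k) \<Rightarrow> 'f" where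
  "ext_disc \<psi> d a = det (mat d d (\<lambda>(i, j). ext_trace \<psi> d (a i * a j)))"

definition OK :: "('a::{finite,field} poly fract \<Rightarrow> 'k::field) \<Rightarrow> 'k set" where
  "OK \<psi> = {x. \<exists>f :: 'a poly poly. lead_coeff f = 1 \<and> poly (map_poly (\<psi> \<circ> embed) f) x = 0}"

text \<open>The discriminant ideal of O_K over F_q[t] is generated by the discriminants of
  d-tuples of elements of O_K.  An irreducible P divides it iff P divides every generator.\<close>
definition disc_ideal_coprime :: "('a::{finite,field} poly fract \<Rightarrow> 'k::field) \<Rightarrow> nat \<Rightarrow> 'a poly \<Rightarrow> bool" where
  "disc_ideal_coprime \<psi> d g \<longleftrightarrow>
     (\<forall>P. irreducible P \<and> P dvd g \<longrightarrow>
        (\<exists>a. (\<forall>i<d. a i \<in> OK \<psi>) \<and> \<not> (\<exists>p. ext_disc \<psi> d a = embed (P * p))))"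

definition carmichael_in :: "('a::{finite,field} poly fract \<Rightarrow> 'k::field) \<Rightarrow> 'k \<Rightarrow> bool" where
  "carmichael_in \<psi> \<alpha> \<longleftrightarrow>
     \<alpha> \<in> OK \<psi> \<and> carmichael_quot (OK \<psi>) {\<alpha> * y | y. y \<in> OK \<psi>}"

end

theory Submission
  imports Defs "Jordan_Normal_Form.Char_Poly"
begin

text \<open>Write \<open>A\<close> for the polynomial ring over the field with \<open>q\<close> elements, \<open>O\<close> for its integral
  closure in \<open>K\<close>, and fix an irreducible factor \<open>P\<close> of \<open>g\<close>. In characteristic \<open>p\<close> the trace
  commutes with the Frobenius map. This makes traces of integral elements lie in \<open>A\<close>, and makes the
  trace of any element that is nilpotent modulo \<open>P\<close> divisible by \<open>P\<close>. If the discriminant of some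
  \<open>d\<close>-tuple in \<open>O\<close> is prime to \<open>P\<close>, Cramer's rule for its Gram matrix then shows that \<open>O/PO\<close> is
  reduced and that the tuple is a basis of it over \<open>A/P\<close>. So every residue field of \<open>O/PO\<close> has
  \<open>q\<close> to the power \<open>j deg P\<close> elements for some \<open>1 \<le> j \<le> d\<close>, and rigidity makes the exponent
  \<open>|O/gO| = q\<close> to the power \<open>d deg g\<close> a power of that number. Hence \<open>x\<close> raised to \<open>|O/gO|\<close> is
  congruent to \<open>x\<close> modulo every prime over \<open>P\<close>, thus modulo \<open>P\<close>, and modulo \<open>g\<close> because \<open>g\<close> is
  square-free. The quotient is not a field because a proper factor of \<open>g\<close> is a non-unit of \<open>O\<close>.\<close>

section \<open>Polynomials over a field\<close>

text \<open>By division with remainder, a nonzero combination of \<open>c\<close> and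
  \<open>P\<close> of least degree divides both. As a divisor of \<open>P\<close> it is a unit or an
  associate of \<open>P\<close>, and an associate would make \<open>P\<close> divide
  \<open>c\<close>.\<close>

lemma irreducible_poly_bezout:
  fixes P c :: "'a::field poly"
  assumes P: "irreducible P" and c: "\<not> P dvd c"
  obtains u v where "u * c + v * P = 1"
proof -
  define S where "S = {u * c + v * P | u v. u * c + v * P \<noteq> 0}"
  have "P \<noteq> 0" using P by auto
  then have "P \<in> S" unfolding S_def by (intro CollectI exI[of _ 0] exI[of _ 1]) auto
  then obtain m where m: "m \<in> S" and min: "\<And>y. y \<in> S \<Longrightarrow> degree m \<le> degree y"
    using ex_has_least_nat[of "\<lambda>y. y \<in> S" P degree] by blast
  from m obtain u v where uv: "m = u * c + v * P" and m0: "m \<noteq> 0" unfolding S_def by auto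
  have dvd: "m dvd y" if y: "y = s * c + t * P" for y s t
  proof -
    have "y mod m = y - (y div m) * m" by (simp add: minus_div_mult_eq_mod)
    also have "\<dots> = (s - (y div m) * u) * c + (t - (y div m) * v) * P"
      unfolding uv by (subst (1) y) (simp add: algebra_simps)
    finally have e: "y mod m = (s - (y div m) * u) * c + (t - (y div m) * v) * P" .
    have "y mod m = 0"
    proof (rule ccontr)
      assume nz: "y mod m \<noteq> 0"
      then have "y mod m \<in> S" unfolding S_def using e by auto
      from min[OF this] nz degree_mod_less'[OF m0, of y] show False by auto
    qed
    then show ?thesis by auto
  qed
  have mP: "m dvd P" by (rule dvd[of _ 0 1]) auto
  have mc: "m dvd c" by (rule dvd[of _ 1 0]) auto
  from mP obtain w where w: "P = m * w" by (rule dvdE)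
  have "is_unit m"
  proof (rule ccontr)
    assume "\<not> is_unit m"
    with P w have "is_unit w" using irreducibleD by blast
    then have "P dvd m" unfolding w by (simp add: mult_unit_dvd_iff)
    with mc c show False using dvd_trans by blast
  qed
  then obtain e where "1 = m * e" by (rule dvdE)
  then have "(e * u) * c + (e * v) * P = 1" unfolding uv by (simp add: algebra_simps)
  then show ?thesis by (rule that)
qed

lemma irreducible_poly_dvd_mult:
  fixes P :: "'a::field poly"
  assumes "irreducible P" "P dvd a * b"
  shows "P dvd a \<or> P dvd b"
  using field_poly_irreducible_imp_prime[OF assms(1)] assms(2) by (rule prime_elem_dvd_multD)

lemma irreducible_poly_dvd_power:
  fixes P :: "'a::field poly"
  assumes "irreducible P" "P dvd a ^ n"
  shows "P dvd a"
  using field_poly_irreducible_imp_prime[OF assms(1)] assms(2) by (rule prime_elem_dvd_power)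

lemma exists_irreducible_poly_factor:
  fixes r :: "'a::field poly"
  assumes "r \<noteq> 0" "\<not> is_unit r"
  shows "\<exists>P. irreducible P \<and> P dvd r"
  using assms
proof (induction "degree r" arbitrary: r rule: less_induct)
  case less
  show ?case
  proof (cases "irreducible r")
    case False
    with less.prems obtain a b where ab: "r = a * b" "\<not> is_unit a" "\<not> is_unit b"
      unfolding irreducible_def by auto
    have nz: "a \<noteq> 0" "b \<noteq> 0" using ab less.prems by auto
    have "degree b > 0" using ab(3) nz(2) is_unit_iff_degree by blast
    then have "degree a < degree r" using nz ab(1) by (simp add: degree_mult_eq)
    from less.hyps[OF this nz(1) ab(2)] ab(1) show ?thesis by (meson dvd_mult2)
  qed auto
qed

text \<open>These are the remainders modulo a polynomial of degree \<open>n\<close>. Zero is listed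
  apart because its degree is 0 by convention, so \<open>degree c < n\<close> alone would lose it at
  \<open>n = 0\<close>.\<close>

lemma card_poly_bounded_degree:
  "finite {c :: 'a::{finite,field} poly. c = 0 \<or> degree c < n} \<and>
   card {c :: 'a poly. c = 0 \<or> degree c < n} = card (UNIV :: 'a set) ^ n"
proof (induction n)
  case 0
  have "{c :: 'a poly. c = 0 \<or> degree c < 0} = {0}" by auto
  then show ?case by simp
next
  case (Suc n)
  let ?S = "\<lambda>n. {c :: 'a poly. c = 0 \<or> degree c < n}"
  have eq: "?S (Suc n) = (\<lambda>(a, p). pCons a p) ` (UNIV \<times> ?S n)"
  proof (intro equalityI subsetI)
    fix c assume c: "c \<in> ?S (Suc n)"
    obtain a p where ap: "c = pCons a p" by (cases c)
    have "p \<in> ?S n" using c ap by (cases "p = 0") auto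
    then show "c \<in> (\<lambda>(a, p). pCons a p) ` (UNIV \<times> ?S n)" using ap by force
  qed (auto split: if_splits)
  have inj: "inj_on (\<lambda>(a, p). pCons a p) (UNIV \<times> ?S n)" by (auto simp: inj_on_def)
  show ?case
    unfolding eq card_image[OF inj] using Suc.IH by (simp add: card_cartesian_product)
qed

text \<open>An irreducible \<open>P\<close> in the reduced denominator would have arbitrarily high
  powers dividing \<open>w\<close>. The exponents only have to be unbounded, because the powers of a
  trace will be controlled just at powers of the characteristic.\<close>

lemma bounded_powers_imp_polynomial:
  fixes f :: "'a::field poly fract"
  assumes w: "w \<noteq> 0" and S: "\<And>m. \<exists>n\<ge>m. embed w * f ^ n \<in> range embed"
  shows "f \<in> range embed"
proof -
  obtain u0 v0 where uv0: "f = Fract u0 v0" "v0 \<noteq> 0" by (cases f)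
  \<comment> \<open>A denominator of least degree stands for lowest terms: cancelling a common
    irreducible factor would lower the degree.\<close>
  let ?R = "\<lambda>v. v \<noteq> 0 \<and> (\<exists>u. f = Fract u v)"
  have "?R v0" using uv0 by auto
  then obtain v where v: "?R v" and min: "\<And>y. ?R y \<Longrightarrow> degree v \<le> degree y"
    using ex_has_least_nat[of ?R v0 degree] by blast
  from v obtain u where f: "f = Fract u v" and v0: "v \<noteq> 0" by auto
  have "is_unit v"
  proof (rule ccontr)
    assume "\<not> is_unit v"
    then obtain P where P: "irreducible P" "P dvd v" using exists_irreducible_poly_factor v0 by blast
    have P0: "P \<noteq> 0" "\<not> is_unit P" using P(1) by (auto simp: irreducible_def)
    have dP: "degree P > 0" using P0 is_unit_iff_degree by blast
    have nPu: "\<not> P dvd u"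
    proof
      assume "P dvd u"
      then obtain u' where u': "u = P * u'" by (rule dvdE)
      from P(2) obtain v' where v': "v = P * v'" by (rule dvdE)
      have "v' \<noteq> 0" using v' v0 by auto
      moreover have "f = Fract u' v'" unfolding f u' v' using P0 by (simp add: mult_fract_cancel)
      ultimately have "degree v \<le> degree v'" using min by blast
      then show False using v' v0 dP by (auto simp: degree_mult_eq)
    qed
    \<comment> \<open>Beyond this bound \<open>P ^ n\<close> has larger degree than
      \<open>w\<close>, so it cannot divide \<open>w\<close>.\<close>
    obtain n where n: "n \<ge> degree w + 1" and "embed w * f ^ n \<in> range embed" using S by blast
    then obtain e where e: "embed w * f ^ n = embed e" by auto
    have fn: "f ^ n = Fract (u ^ n) (v ^ n)" for n
      by (induction n) (auto simp: f One_fract_def)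
    have weq: "w * u ^ n = e * v ^ n" using e unfolding fn embed_def by (simp add: eq_fract v0)
    have Pn: "P ^ n dvd w * u ^ n" unfolding weq using P(2) by (simp add: dvd_power_same)
    have "P ^ n dvd w"
    proof -
      have "P ^ k dvd w" if "P ^ k dvd w * y" "\<not> P dvd y" for y k
        using that
      proof (induction k)
        case (Suc k)
        then have "P ^ k dvd w" by (meson dvd_power_le dvd_refl dvd_trans le_imp_power_dvd lessI less_imp_le)
        then obtain z where z: "w = P ^ k * z" by (rule dvdE)
        have "P dvd z * y" using Suc.prems(1) P0 unfolding z by (simp add: mult.assoc mult.commute[of P])
        then have "P dvd z" using irreducible_poly_dvd_mult[OF P(1)] Suc.prems by blast
        then show ?case unfolding z by (simp add: mult.commute mult_dvd_mono)
      qed simp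
      then show ?thesis using Pn nPu irreducible_poly_dvd_power[OF P(1)] by blast
    qed
    then have "degree (P ^ n) \<le> degree w" using w dvd_imp_degree_le by blast
    moreover have "degree (P ^ n) = n * degree P" using P0 by (simp add: degree_power_eq)
    moreover have "n * degree P \<ge> n" using dP by simp
    ultimately show False using n by linarith
  qed
  then obtain v' where v': "1 = v * v'" by (rule dvdE)
  have "f = embed (u * v')"
    unfolding f embed_def using v0 v' by (simp add: eq_fract) (metis mult.commute mult.left_commute mult.right_neutral)
  then show ?thesis by auto
qed

section \<open>Transversals and quotients\<close>

definition add_subgroup :: "'k::comm_ring_1 set \<Rightarrow> bool" where
  "add_subgroup H \<longleftrightarrow> 0 \<in> H \<and> (\<forall>x\<in>H. \<forall>y\<in>H. x - y \<in> H)"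

lemma add_subgroup_zero: "add_subgroup H \<Longrightarrow> 0 \<in> H"
  and add_subgroup_diff: "add_subgroup H \<Longrightarrow> x \<in> H \<Longrightarrow> y \<in> H \<Longrightarrow> x - y \<in> H"
  by (auto simp: add_subgroup_def)

lemma add_subgroup_uminus:
  assumes "add_subgroup H" "x \<in> H"
  shows "- x \<in> H"
  using add_subgroup_diff[OF assms(1) add_subgroup_zero[OF assms(1)] assms(2)] by simp

lemma add_subgroup_add:
  assumes "add_subgroup H" "x \<in> H" "y \<in> H"
  shows "x + y \<in> H"
  using add_subgroup_diff[OF assms(1,2) add_subgroup_uminus[OF assms(1,3)]] by simp

lemma add_subgroup_sum:
  assumes "add_subgroup H" "\<And>i. i \<in> S \<Longrightarrow> f i \<in> H"
  shows "sum f S \<in> H"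
  using assms(2)
  by (induction S rule: infinite_finite_induct)
    (auto intro: add_subgroup_zero[OF assms(1)] add_subgroup_add[OF assms(1)])

text \<open>The index is witnessed by a transversal. Finiteness is then part of the notion, and
  indices can be multiplied and rescaled by working on representatives.\<close>

definition has_index :: "'k::comm_ring_1 set \<Rightarrow> 'k set \<Rightarrow> nat \<Rightarrow> bool" where
  "has_index J I n \<longleftrightarrow>
     (\<exists>T. finite T \<and> card T = n \<and> T \<subseteq> J \<and> (\<forall>x\<in>J. \<exists>t\<in>T. x - t \<in> I) \<and>
          (\<forall>t\<in>T. \<forall>s\<in>T. t - s \<in> I \<longrightarrow> t = s))"

lemma has_index_self:
  assumes "add_subgroup I"
  shows "has_index I I 1"
  unfolding has_index_def using add_subgroup_zero[OF assms] by (intro exI[of _ "{0}"]) auto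

text \<open>Sending a representative to its coset is a bijection from the transversal onto the
  cosets. This translates indices into the cardinality that occurs in
  \<open>carmichael_quot\<close>.\<close>

lemma cosets_card_eq_index:
  assumes I: "add_subgroup I" and "has_index J I n"
  shows "finite (cosets J I)" "card (cosets J I) = n"
proof -
  from assms(2) obtain T where T: "finite T" "card T = n" "T \<subseteq> J"
      "\<And>x. x \<in> J \<Longrightarrow> \<exists>t\<in>T. x - t \<in> I" "\<And>t s. t \<in> T \<Longrightarrow> s \<in> T \<Longrightarrow> t - s \<in> I \<Longrightarrow> t = s"
    unfolding has_index_def by blast
  define C where "C x = {x + i | i. i \<in> I}" for x
  have C_iff: "C x = C y \<longleftrightarrow> x - y \<in> I" for x y
  proof
    assume e: "C x = C y"
    have "x \<in> C x" unfolding C_def using add_subgroup_zero[OF I] by force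
    with e have "x \<in> C y" by simp
    then obtain i where "x = y + i" "i \<in> I" unfolding C_def by blast
    then show "x - y \<in> I" by simp
  next
    assume xy: "x - y \<in> I"
    have sub: "C u \<subseteq> C v" if "u - v \<in> I" for u v
    proof
      fix z assume "z \<in> C u"
      then obtain i where "z = u + i" "i \<in> I" unfolding C_def by blast
      then have "z = v + ((u - v) + i)" "(u - v) + i \<in> I" using add_subgroup_add[OF I that] by auto
      then show "z \<in> C v" unfolding C_def by blast
    qed
    have "y - x \<in> I" using add_subgroup_uminus[OF I xy] by simp
    with xy show "C x = C y" using sub by blast
  qed
  have "cosets J I = C ` T"
  proof (intro equalityI subsetI)
    fix c assume "c \<in> cosets J I"
    then obtain x where x: "x \<in> J" "c = C x" unfolding cosets_def C_def by blast
    with T(4) obtain t where "t \<in> T" "x - t \<in> I" by blast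
    then show "c \<in> C ` T" using x(2) C_iff by blast
  next
    fix c assume "c \<in> C ` T"
    then show "c \<in> cosets J I" unfolding cosets_def C_def using T(3) by blast
  qed
  moreover have "inj_on C T" unfolding inj_on_def C_iff using T(5) by blast
  ultimately show "finite (cosets J I)" "card (cosets J I) = n" using T(1,2) by (auto simp: card_image)
qed

text \<open>The sums \<open>t + s\<close> of representatives of the two steps form a transversal: a
  congruence modulo \<open>I\<close> reduces modulo \<open>J\<close> to \<open>t = t'\<close>, and
  what remains compares \<open>s\<close> with \<open>s'\<close>.\<close>

lemma has_index_mult:
  assumes I: "add_subgroup I" and J: "add_subgroup J" and L: "add_subgroup L"
    and sub: "I \<subseteq> J" "J \<subseteq> L" and LJ: "has_index L J m" and JI: "has_index J I n"
  shows "has_index L I (m * n)"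
proof -
  from LJ obtain T where T: "finite T" "card T = m" "T \<subseteq> L"
      "\<And>x. x \<in> L \<Longrightarrow> \<exists>t\<in>T. x - t \<in> J" "\<And>t s. t \<in> T \<Longrightarrow> s \<in> T \<Longrightarrow> t - s \<in> J \<Longrightarrow> t = s"
    unfolding has_index_def by blast
  from JI obtain S where S: "finite S" "card S = n" "S \<subseteq> J"
      "\<And>x. x \<in> J \<Longrightarrow> \<exists>t\<in>S. x - t \<in> I" "\<And>t s. t \<in> S \<Longrightarrow> s \<in> S \<Longrightarrow> t - s \<in> I \<Longrightarrow> t = s"
    unfolding has_index_def by blast
  let ?f = "\<lambda>(t, s). t + s"
  have sep: "t = t' \<and> s = s'"
    if h: "t \<in> T" "t' \<in> T" "s \<in> S" "s' \<in> S" "(t + s) - (t' + s') \<in> I" for t t' s s'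
  proof -
    have "s - s' \<in> J" using add_subgroup_diff[OF J] S(3) h by blast
    moreover have "(t + s) - (t' + s') \<in> J" using sub h by blast
    ultimately have "((t + s) - (t' + s')) - (s - s') \<in> J" using add_subgroup_diff[OF J] by blast
    then have "t - t' \<in> J" by (simp add: algebra_simps)
    then have "t = t'" using T(5) h by blast
    then show ?thesis using h S(5)[of s s'] by simp
  qed
  have inj: "inj_on ?f (T \<times> S)"
  proof (rule inj_onI, clarify)
    fix t s t' s' assume h: "t \<in> T" "s \<in> S" "t' \<in> T" "s' \<in> S" "t + s = t' + s'"
    then show "t = t' \<and> s = s'" using sep[of t t' s s'] add_subgroup_zero[OF I] by simp
  qed
  have "has_index L I (card (?f ` (T \<times> S)))"
    unfolding has_index_def
  proof (intro exI[of _ "?f ` (T \<times> S)"] conjI ballI impI)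
    show "?f ` (T \<times> S) \<subseteq> L" using T(3) S(3) sub by (auto intro!: add_subgroup_add[OF L])
  next
    fix x assume "x \<in> L"
    then obtain t where t: "t \<in> T" "x - t \<in> J" using T(4) by blast
    then obtain s where s: "s \<in> S" "x - t - s \<in> I" using S(4) by blast
    then have "x - (t + s) \<in> I" by (simp add: algebra_simps)
    then show "\<exists>t\<in>?f ` (T \<times> S). x - t \<in> I" using t s by force
  next
    fix u v assume "u \<in> ?f ` (T \<times> S)" "v \<in> ?f ` (T \<times> S)" "u - v \<in> I"
    then show "u = v" using sep by auto
  qed (use T S in auto)
  then show ?thesis using T S by (simp add: card_image[OF inj] card_cartesian_product)
qed

text \<open>Multiplication by \<open>p\<close> is additive and injective, so it carries transversals
  to transversals. It will move the index of \<open>sO\<close> in \<open>O\<close> to that of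
  \<open>PsO\<close> in \<open>PO\<close>.\<close>

lemma has_index_scale:
  fixes p :: "'k::idom"
  assumes "p \<noteq> 0" "has_index J I n"
  shows "has_index ((*) p ` J) ((*) p ` I) n"
proof -
  from assms(2) obtain T where T: "finite T" "card T = n" "T \<subseteq> J"
      "\<And>x. x \<in> J \<Longrightarrow> \<exists>t\<in>T. x - t \<in> I" "\<And>t s. t \<in> T \<Longrightarrow> s \<in> T \<Longrightarrow> t - s \<in> I \<Longrightarrow> t = s"
    unfolding has_index_def by blast
  have inj: "inj ((*) p)" using assms(1) by (auto simp: inj_def)
  show ?thesis
    unfolding has_index_def
  proof (intro exI[of _ "(*) p ` T"] conjI ballI impI)
    show "card ((*) p ` T) = n" using T(2) card_image[OF inj_on_subset[OF inj]] by simp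
  next
    fix x assume "x \<in> (*) p ` J"
    then obtain y where y: "y \<in> J" "x = p * y" by auto
    then obtain t where "t \<in> T" "y - t \<in> I" using T(4) by blast
    then show "\<exists>t\<in>(*) p ` T. x - t \<in> (*) p ` I"
      unfolding y by (intro bexI[of _ "p * t"]) (auto simp: right_diff_distrib[symmetric])
  next
    fix u v assume "u \<in> (*) p ` T" "v \<in> (*) p ` T" "u - v \<in> (*) p ` I"
    then obtain t s i where "u = p * t" "v = p * s" "u - v = p * i" "t \<in> T" "s \<in> T" "i \<in> I" by auto
    then show "u = v" using T(5)[of t s] assms(1) by (simp add: right_diff_distrib[symmetric])
  qed (use T in auto)
qed

section \<open>Ideals of finite index and Fermat's little theorem\<close>

definition is_subring :: "'k::comm_ring_1 set \<Rightarrow> bool" where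
  "is_subring R \<longleftrightarrow> add_subgroup R \<and> 1 \<in> R \<and> (\<forall>x\<in>R. \<forall>y\<in>R. x * y \<in> R)"

definition is_ideal :: "'k::comm_ring_1 set \<Rightarrow> 'k set \<Rightarrow> bool" where
  "is_ideal R I \<longleftrightarrow> add_subgroup I \<and> I \<subseteq> R \<and> (\<forall>r\<in>R. \<forall>i\<in>I. r * i \<in> I)"

definition is_prime_ideal :: "'k::comm_ring_1 set \<Rightarrow> 'k set \<Rightarrow> bool" where
  "is_prime_ideal R I \<longleftrightarrow> is_ideal R I \<and> 1 \<notin> I \<and> (\<forall>x\<in>R. \<forall>y\<in>R. x * y \<in> I \<longrightarrow> x \<in> I \<or> y \<in> I)"

lemma is_subring_power: "is_subring R \<Longrightarrow> x \<in> R \<Longrightarrow> x ^ n \<in> R"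
  by (induction n) (auto simp: is_subring_def)

lemma is_subring_prod: "is_subring R \<Longrightarrow> (\<And>i. i \<in> S \<Longrightarrow> f i \<in> R) \<Longrightarrow> prod f S \<in> R"
  by (induction S rule: infinite_finite_induct) (auto simp: is_subring_def)

lemma ideal_prod_cong:
  assumes R: "is_subring R" and I: "is_ideal R I"
    and "\<And>i. i \<in> S \<Longrightarrow> f i \<in> R" "\<And>i. i \<in> S \<Longrightarrow> g i \<in> R" "\<And>i. i \<in> S \<Longrightarrow> f i - g i \<in> I"
  shows "prod f S - prod g S \<in> I"
  using assms(3-)
proof (induction S rule: infinite_finite_induct)
  case (insert a S)
  have I': "add_subgroup I" using I by (auto simp: is_ideal_def)
  have "f a * prod f S - g a * prod g S = prod f S * (f a - g a) + g a * (prod f S - prod g S)"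
    by (simp add: algebra_simps)
  also have "\<dots> \<in> I"
    using insert I is_subring_prod[OF R, of S f]
    by (intro add_subgroup_add[OF I']) (auto simp: is_ideal_def)
  finally show ?case using insert.hyps by simp
qed (use I in \<open>auto simp: is_ideal_def add_subgroup_def\<close>)

text \<open>Multiplication by an element outside the ideal permutes the nonzero residue classes;
  comparing the products over all of them gives Fermat's little theorem.\<close>

lemma prime_ideal_power_index:
  assumes R: "is_subring R" and pI: "is_prime_ideal R I" and idx: "has_index R I n" and x: "x \<in> R"
  shows "x ^ n - x \<in> I"
proof -
  have I: "is_ideal R I" and I': "add_subgroup I" using pI by (auto simp: is_prime_ideal_def is_ideal_def)
  have mult: "\<And>r i. r \<in> R \<Longrightarrow> i \<in> I \<Longrightarrow> r * i \<in> I" using I by (auto simp: is_ideal_def)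
  have prime: "\<And>x y. x \<in> R \<Longrightarrow> y \<in> R \<Longrightarrow> x * y \<in> I \<Longrightarrow> x \<in> I \<or> y \<in> I"
    using pI by (auto simp: is_prime_ideal_def)
  have Rm: "\<And>x y. x \<in> R \<Longrightarrow> y \<in> R \<Longrightarrow> x * y \<in> R"
    and Rd: "\<And>x y. x \<in> R \<Longrightarrow> y \<in> R \<Longrightarrow> x - y \<in> R" and R0: "0 \<in> R" and R1: "1 \<in> R"
    using R by (auto simp: is_subring_def add_subgroup_def)
  from idx obtain T where T: "finite T" "card T = n" "T \<subseteq> R"
      "\<And>x. x \<in> R \<Longrightarrow> \<exists>t\<in>T. x - t \<in> I" "\<And>t s. t \<in> T \<Longrightarrow> s \<in> T \<Longrightarrow> t - s \<in> I \<Longrightarrow> t = s"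
    unfolding has_index_def by blast
  obtain t0 where t0: "t0 \<in> T" "0 - t0 \<in> I" using T(4) R0 by blast
  then have t0I: "t0 \<in> I" using add_subgroup_uminus[OF I', of "0 - t0"] by simp
  have "n > 0" using T t0 by (auto simp: card_gt_0_iff)
  then have xn: "x ^ n = x * x ^ (n - 1)" by (cases n) auto
  show ?thesis
  proof (cases "x \<in> I")
    case True
    have "x * x ^ (n - 1) \<in> I" using mult[OF is_subring_power[OF R x] True] by (simp add: mult.commute)
    then have "x ^ n \<in> I" unfolding xn .
    then show ?thesis using True add_subgroup_diff[OF I'] by blast
  next
    case xI: False
    \<comment> \<open>\<open>t0\<close> represents the zero class, so \<open>T0\<close> represents
      the nonzero classes.\<close>
    define T0 where "T0 = T - {t0}"
    have T0: "finite T0" "card T0 = n - 1" "T0 \<subseteq> R" using T t0 by (auto simp: T0_def)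
    have T0I: "t \<notin> I" if "t \<in> T0" for t
      using that T(5)[of t t0] t0 add_subgroup_diff[OF I' _ t0I] by (auto simp: T0_def)
    define \<sigma> where "\<sigma> t = (SOME s. s \<in> T \<and> x * t - s \<in> I)" for t
    have \<sigma>: "\<sigma> t \<in> T" "x * t - \<sigma> t \<in> I" if "t \<in> T0" for t
    proof -
      have "x * t \<in> R" using that T0(3) by (intro Rm[OF x]) auto
      then have "\<exists>s. s \<in> T \<and> x * t - s \<in> I" using T(4) by blast
      from someI_ex[OF this] show "\<sigma> t \<in> T" "x * t - \<sigma> t \<in> I" by (auto simp: \<sigma>_def)
    qed
    have "\<sigma> t \<in> T0" if t: "t \<in> T0" for t
    proof (rule ccontr)
      assume "\<sigma> t \<notin> T0"
      then have "\<sigma> t = t0" using \<sigma>(1)[OF t] by (auto simp: T0_def)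
      then have "x * t \<in> I" using \<sigma>(2)[OF t] add_subgroup_add[OF I' _ t0I, of "x * t - t0"] by simp
      moreover have "t \<in> R" using t T0(3) by auto
      ultimately show False using prime[of x t] x xI T0I[OF t] by simp
    qed
    then have maps: "\<sigma> ` T0 \<subseteq> T0" by auto
    have inj: "inj_on \<sigma> T0"
    proof (rule inj_onI)
      fix t s assume ts: "t \<in> T0" "s \<in> T0" "\<sigma> t = \<sigma> s"
      have "(x * t - \<sigma> t) - (x * s - \<sigma> s) \<in> I" by (rule add_subgroup_diff[OF I' \<sigma>(2)[OF ts(1)] \<sigma>(2)[OF ts(2)]])
      then have "x * (t - s) \<in> I" using ts(3) by (simp add: algebra_simps)
      moreover have "t - s \<in> R" using ts T0(3) by (intro Rd) auto
      ultimately have "t - s \<in> I" using prime[of x "t - s"] x xI by simp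
      then show "t = s" using T(5) ts by (auto simp: T0_def)
    qed
    have img: "\<sigma> ` T0 = T0" using endo_inj_surj[OF T0(1) maps inj] .
    define pr where "pr = \<Prod>T0"
    have "prod \<sigma> T0 = \<Prod>(\<sigma> ` T0)" by (simp add: prod.reindex[OF inj])
    then have prod_perm: "prod \<sigma> T0 = pr" unfolding img pr_def .
    have "(\<Prod>t\<in>T0. x * t) - prod \<sigma> T0 \<in> I"
    proof (rule ideal_prod_cong[OF R I])
      fix t assume t: "t \<in> T0"
      show "x * t \<in> R" using t T0(3) by (intro Rm[OF x]) auto
      show "\<sigma> t \<in> R" using \<sigma>(1)[OF t] T(3) by auto
      show "x * t - \<sigma> t \<in> I" using \<sigma>(2)[OF t] .
    qed
    then have "x ^ (n - 1) * pr - pr \<in> I" unfolding prod_perm by (simp add: prod.distrib pr_def T0(2))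
    then have *: "(x ^ (n - 1) - 1) * pr \<in> I" by (simp add: algebra_simps)
    have prR: "pr \<in> R" unfolding pr_def using T0(3) by (intro is_subring_prod[OF R]) auto
    \<comment> \<open>To be cancelled, \<open>pr\<close> must lie outside \<open>I\<close>;
      primality passes this from the factors to the product.\<close>
    have "\<Prod>S \<notin> I" if "finite S" "S \<subseteq> T0" for S
      using that
    proof (induction S rule: finite_induct)
      case empty
      then show ?case using pI by (auto simp: is_prime_ideal_def)
    next
      case (insert a S)
      have "\<Prod>S \<in> R" using insert T0(3) by (intro is_subring_prod[OF R]) auto
      then show ?case using insert prime[of a "\<Prod>S"] T0(3) T0I by auto
    qed
    then have "pr \<notin> I" using T0(1) unfolding pr_def by blast
    with * have "x ^ (n - 1) - 1 \<in> I"
      using prime[OF Rd[OF is_subring_power[OF R x] R1] prR] by simp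
    from mult[OF x this] show ?thesis unfolding xn by (simp add: algebra_simps)
  qed
qed

text \<open>Fermat's little theorem is iterated \<open>m\<close> times. Rigidity will present
  \<open>|O/gO|\<close> as such a power of the size of a residue field.\<close>

lemma prime_ideal_power_index_power:
  assumes R: "is_subring R" and pI: "is_prime_ideal R I" and idx: "has_index R I n" and x: "x \<in> R"
  shows "x ^ (n ^ m) - x \<in> I"
proof (induction m)
  case 0
  then show ?case using pI by (simp add: is_prime_ideal_def is_ideal_def add_subgroup_def)
next
  case (Suc m)
  have I': "add_subgroup I" using pI by (auto simp: is_prime_ideal_def is_ideal_def)
  have "(x ^ (n ^ m)) ^ n - x ^ (n ^ m) \<in> I"
    by (rule prime_ideal_power_index[OF R pI idx is_subring_power[OF R x]])
  from add_subgroup_add[OF I' this Suc.IH] show ?case by (simp add: power_mult[symmetric] mult.commute)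
qed

lemma ideal_adjoin:
  assumes R: "is_subring R" and I: "is_ideal R I" and x: "x \<in> R"
  shows "is_ideal R {i + r * x | i r. i \<in> I \<and> r \<in> R}" "I \<subseteq> {i + r * x | i r. i \<in> I \<and> r \<in> R}"
    "x \<in> {i + r * x | i r. i \<in> I \<and> r \<in> R}"
proof -
  let ?J = "{i + r * x | i r. i \<in> I \<and> r \<in> R}"
  have I': "add_subgroup I" "I \<subseteq> R" "\<And>r i. r \<in> R \<Longrightarrow> i \<in> I \<Longrightarrow> r * i \<in> I"
    using I by (auto simp: is_ideal_def)
  have R': "add_subgroup R" "1 \<in> R" "\<And>x y. x \<in> R \<Longrightarrow> y \<in> R \<Longrightarrow> x * y \<in> R"
    using R by (auto simp: is_subring_def)
  show sub: "I \<subseteq> ?J"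
  proof
    fix i assume "i \<in> I"
    then show "i \<in> ?J" using add_subgroup_zero[OF R'(1)] by (intro CollectI exI[of _ i] exI[of _ 0]) auto
  qed
  show "x \<in> ?J" using add_subgroup_zero[OF I'(1)] R'(2) by (intro CollectI exI[of _ 0] exI[of _ 1]) auto
  show "is_ideal R ?J"
    unfolding is_ideal_def add_subgroup_def
  proof (intro conjI ballI)
    show "0 \<in> ?J" using sub add_subgroup_zero[OF I'(1)] by blast
  next
    fix u v assume "u \<in> ?J" "v \<in> ?J"
    then obtain i r j s where *: "u = i + r * x" "v = j + s * x" "i \<in> I" "j \<in> I" "r \<in> R" "s \<in> R"
      by blast
    have "u - v = (i - j) + (r - s) * x" using * by (simp add: algebra_simps)
    then show "u - v \<in> ?J" using * add_subgroup_diff[OF I'(1)] add_subgroup_diff[OF R'(1)] by blast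
  next
    show "?J \<subseteq> R" using I'(2) R'(3) x by (auto intro!: add_subgroup_add[OF R'(1)])
  next
    fix r u assume "r \<in> R" "u \<in> ?J"
    then obtain i s where *: "u = i + s * x" "i \<in> I" "s \<in> R" by blast
    have "r * u = r * i + (r * s) * x" using * by (simp add: algebra_simps)
    then show "r * u \<in> ?J" using * I'(3) R'(3) \<open>r \<in> R\<close> by blast
  qed
qed

text \<open>An ideal over \<open>J\<close> maximal among those containing no power of
  \<open>b\<close> is prime. Finite index provides the maximal one:
  \<open>card (T \<inter> I)\<close> is at most \<open>n\<close> and measures the size of
  \<open>I\<close>.\<close>

lemma exists_prime_ideal_avoiding:
  assumes R: "is_subring R" and J: "is_ideal R J" and idx: "has_index R J n"
    and b: "b \<in> R" and nil: "\<And>m. b ^ m \<notin> J"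
  obtains I where "is_prime_ideal R I" "J \<subseteq> I" "b \<notin> I"
proof -
  from idx obtain T where T: "finite T" "card T = n" "T \<subseteq> R"
      "\<And>x. x \<in> R \<Longrightarrow> \<exists>t\<in>T. x - t \<in> J" "\<And>t s. t \<in> T \<Longrightarrow> s \<in> T \<Longrightarrow> t - s \<in> J \<Longrightarrow> t = s"
    unfolding has_index_def by blast
  let ?A = "\<lambda>I. is_ideal R I \<and> J \<subseteq> I \<and> (\<forall>m. b ^ m \<notin> I)"
  have "?A J" using J nil by auto
  moreover have "\<forall>I. ?A I \<longrightarrow> card (T \<inter> I) < Suc n"
    by (simp add: less_Suc_eq_le T(2)[symmetric] card_mono[OF T(1)])
  ultimately have "\<exists>I. ?A I \<and> (\<forall>I'. ?A I' \<longrightarrow> card (T \<inter> I') \<le> card (T \<inter> I))"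
    by (rule ex_has_greatest_nat[of ?A J "\<lambda>I. card (T \<inter> I)" "Suc n"])
  then obtain I where I: "?A I" and max: "\<And>I'. ?A I' \<Longrightarrow> card (T \<inter> I') \<le> card (T \<inter> I)"
    by blast
  have Rm: "\<And>x y. x \<in> R \<Longrightarrow> y \<in> R \<Longrightarrow> x * y \<in> R" using R by (auto simp: is_subring_def)
  have I': "add_subgroup I" "I \<subseteq> R" "\<And>r i. r \<in> R \<Longrightarrow> i \<in> I \<Longrightarrow> r * i \<in> I"
    using I by (auto simp: is_ideal_def)
  have big: "\<exists>m i r. b ^ m = i + r * x \<and> i \<in> I \<and> r \<in> R" if x: "x \<in> R" "x \<notin> I" for x
  proof (rule ccontr)
    assume no: "\<not> ?thesis"
    obtain K where K: "is_ideal R K" "I \<subseteq> K" "x \<in> K"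
      and mem: "\<And>z. z \<in> K \<Longrightarrow> \<exists>i r. z = i + r * x \<and> i \<in> I \<and> r \<in> R"
      using ideal_adjoin[OF R I[THEN conjunct1] x(1)] by blast
    have "b ^ m \<notin> K" for m using no mem by blast
    moreover have "J \<subseteq> K" using I K(2) by auto
    ultimately have "?A K" using K(1) by simp
    from max[OF this] have le: "card (T \<inter> K) \<le> card (T \<inter> I)" .
    have K': "add_subgroup K" using K(1) by (auto simp: is_ideal_def)
    \<comment> \<open>Both ideals contain \<open>J\<close>, so the representative \<open>t\<close>
      of \<open>x\<close> lies in \<open>K\<close> but not in \<open>I\<close>; the count grows
      strictly from \<open>I\<close> to \<open>K\<close>.\<close>
    obtain t where t: "t \<in> T" "x - t \<in> J" using T(4) x by blast
    have "x - (x - t) \<in> K" using add_subgroup_diff[OF K' K(3)] t(2) I K(2) by blast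
    moreover have "t \<notin> I"
    proof
      assume "t \<in> I"
      then have "(x - t) + t \<in> I" using add_subgroup_add[OF I'(1)] t(2) I by blast
      then show False using x by simp
    qed
    ultimately have "T \<inter> I \<subset> T \<inter> K" using K(2) t(1) by auto
    then have "card (T \<inter> I) < card (T \<inter> K)" using T(1) by (intro psubset_card_mono) auto
    then show False using le by simp
  qed
  have "is_prime_ideal R I"
    unfolding is_prime_ideal_def
  proof (intro conjI ballI impI)
    show "is_ideal R I" using I by blast
    show "1 \<notin> I" using I[THEN conjunct2, THEN conjunct2, THEN spec, of 0] by simp
  next
    fix x y assume xy: "x \<in> R" "y \<in> R" "x * y \<in> I"
    show "x \<in> I \<or> y \<in> I"
    proof (rule ccontr)
      assume "\<not> ?thesis"
      then have xyI: "x \<notin> I" "y \<notin> I" by auto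
      from big[OF xy(1) xyI(1)] obtain m i r where h1: "b ^ m = i + r * x" "i \<in> I" "r \<in> R" by blast
      from big[OF xy(2) xyI(2)] obtain k j s where h2: "b ^ k = j + s * y" "j \<in> I" "s \<in> R" by blast
      note h = h1 h2
      \<comment> \<open>Expanding the product of the two expressions, every term has a factor
        \<open>i\<close>, \<open>j\<close> or \<open>x * y\<close> from \<open>I\<close>.\<close>
      have "b ^ (m + k) = (j + s * y) * i + ((r * x) * j + (r * s) * (x * y))"
        unfolding power_add h(1,4) by (simp add: algebra_simps)
      also have "\<dots> \<in> I"
        using I'(3)[OF _ h(2), of "j + s * y"] I'(3)[OF Rm[OF h(3) xy(1)] h(5)]
          I'(3)[OF Rm[OF h(3,6)] xy(3)] is_subring_power[OF R b, of k] h(4)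
        by (intro add_subgroup_add[OF I'(1)]) simp_all
      finally show False using I by blast
    qed
  qed
  moreover have "b \<notin> I" using I[THEN conjunct2, THEN conjunct2, THEN spec, of 1] by simp
  ultimately show ?thesis using I that by blast
qed

section \<open>The trace and the Frobenius map\<close>

lemma prod_one_plus_monom:
  fixes a :: "nat \<Rightarrow> 'f::comm_ring_1"
  assumes "finite S"
  shows "\<exists>h. (\<Prod>i\<in>S. 1 + monom (a i) m) = 1 + monom (\<Sum>i\<in>S. a i) m + monom 1 (2 * m) * h"
  using assms
proof (induction S rule: finite_induct)
  case empty
  then show ?case by (intro exI[of _ 0]) auto
next
  case (insert j S)
  let ?s = "\<Sum>i\<in>S. a i"
  from insert obtain h where h: "(\<Prod>i\<in>S. 1 + monom (a i) m) = 1 + monom ?s m + monom 1 (2 * m) * h"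
    by blast
  have mm: "monom (a j) m * monom ?s m = monom 1 (2 * m) * monom (a j * ?s) 0"
    by (simp add: mult_monom mult_2 del: monom_0)
  have "(1 + monom (a j) m) * (1 + monom ?s m + monom 1 (2 * m) * h)
      = 1 + (monom (a j) m + monom ?s m) + monom (a j) m * monom ?s m
        + monom 1 (2 * m) * ((1 + monom (a j) m) * h)"
    by (simp add: algebra_simps)
  also have "\<dots> = 1 + monom (a j + ?s) m + monom 1 (2 * m) * (monom (a j * ?s) 0 + (1 + monom (a j) m) * h)"
    unfolding mm add_monom by (simp add: distrib_left add.assoc del: monom_0)
  finally show ?case using insert h by auto
qed

text \<open>In the Leibniz formula a permutation other than the identity moves some \<open>i\<close>
  and also \<open>p i\<close>, and the two off-diagonal factors already give degree
  \<open>2 * m\<close>. Only the diagonal contributes below that. The exponent \<open>m\<close> is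
  general because the expansion is applied both at 1 and at the characteristic.\<close>

lemma det_one_plus_monom:
  fixes a :: "nat \<Rightarrow> nat \<Rightarrow> 'f::comm_ring_1"
  shows "\<exists>h. det (mat d d (\<lambda>(i, j). (if i = j then 1 else 0) + monom (a i j) m))
    = 1 + monom (\<Sum>i<d. a i i) m + monom 1 (2 * m) * h"
proof -
  let ?A = "mat d d (\<lambda>(i, j). (if i = j then 1 else 0) + monom (a i j) m)"
  let ?Ps = "{p. p permutes {0..<d}}"
  let ?t = "\<lambda>p. signof p * (\<Prod>i = 0..<d. ?A $$ (i, p i))"
  have "det ?A = sum ?t ?Ps" by (rule det_def') auto
  also have "\<dots> = ?t id + sum ?t (?Ps - {id})"
    by (rule sum.remove) (auto simp: finite_permutations permutes_id)
  finally have det: "det ?A = ?t id + sum ?t (?Ps - {id})" .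
  have dvd: "monom 1 (2 * m) dvd ?t p" if "p \<in> ?Ps - {id}" for p
  proof -
    from that have p: "p permutes {0..<d}" "p \<noteq> id" by auto
    then obtain i where i: "p i \<noteq> i" by (auto simp: fun_eq_iff)
    have iS: "i \<in> {0..<d}" using permutes_not_in[OF p(1), of i] i by blast
    have piS: "p i \<in> {0..<d}" using permutes_in_image[OF p(1)] iS by blast
    have ppi: "p (p i) \<noteq> p i" using permutes_inj[OF p(1)] i by (auto dest: injD)
    have ppiS: "p (p i) \<in> {0..<d}" using permutes_in_image[OF p(1)] piS by blast
    have sub: "{i, p i} \<subseteq> {0..<d}" using iS piS by auto
    have "(\<Prod>i = 0..<d. ?A $$ (i, p i))
      = (\<Prod>i\<in>{0..<d} - {i, p i}. ?A $$ (i, p i)) * (\<Prod>i\<in>{i, p i}. ?A $$ (i, p i))"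
      by (rule prod.subset_diff[OF sub]) auto
    also have "(\<Prod>i\<in>{i, p i}. ?A $$ (i, p i)) = monom 1 (2 * m) * monom (a i (p i) * a (p i) (p (p i))) 0"
      using i ppi iS piS ppiS by (simp add: mult_monom mult_2 del: monom_0)
    finally show ?thesis by (simp only:) (intro dvd_mult dvd_mult2 dvd_refl)
  qed
  have "monom 1 (2 * m) dvd sum ?t (?Ps - {id})" using dvd by (rule dvd_sum)
  then obtain h1 where h1: "sum ?t (?Ps - {id}) = monom 1 (2 * m) * h1" by (rule dvdE)
  have "?t id = (\<Prod>i = 0..<d. 1 + monom (a i i) m)" by simp
  moreover obtain h2 where "(\<Prod>i\<in>{0..<d}. 1 + monom (a i i) m)
      = 1 + monom (\<Sum>i\<in>{0..<d}. a i i) m + monom 1 (2 * m) * h2"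
    using prod_one_plus_monom[of "{0..<d}" "\<lambda>i. a i i" m] by auto
  ultimately have "det ?A = 1 + monom (\<Sum>i<d. a i i) m + monom 1 (2 * m) * (h2 + h1)"
    unfolding det h1 by (simp add: algebra_simps atLeast0LessThan)
  then show ?thesis by blast
qed

section \<open>Coordinates, trace and norm in a finite extension\<close>

locale field_ext =
  fixes \<psi> :: "'f::field \<Rightarrow> 'k::field" and d :: nat
  assumes hom: "is_field_hom \<psi>" and deg: "ext_degree \<psi> d"
begin

lemma hom_1 [simp]: "\<psi> 1 = 1"
  and hom_add: "\<psi> (x + y) = \<psi> x + \<psi> y"
  and hom_mult: "\<psi> (x * y) = \<psi> x * \<psi> y"
  using hom by (auto simp: is_field_hom_def)

lemma hom_0 [simp]: "\<psi> 0 = 0"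
  using hom_add[of 0 0] by (metis add_0 add_cancel_right_right)

lemma hom_uminus: "\<psi> (- x) = - \<psi> x"
  using hom_add[of x "- x"] by (simp add: eq_neg_iff_add_eq_0 add.commute)

lemma hom_diff: "\<psi> (x - y) = \<psi> x - \<psi> y"
  using hom_add[of x "- y"] by (simp add: hom_uminus)

lemma hom_eq_0_iff [simp]: "\<psi> x = 0 \<longleftrightarrow> x = 0"
proof
  assume "\<psi> x = 0"
  then show "x = 0" using hom_mult[of x "inverse x"] by (cases "x = 0") auto
qed simp

lemma hom_eq_iff [simp]: "\<psi> x = \<psi> y \<longleftrightarrow> x = y"
  using hom_eq_0_iff[of "x - y"] by (simp add: hom_diff del: hom_eq_0_iff)

lemma hom_sum: "\<psi> (sum f S) = (\<Sum>i\<in>S. \<psi> (f i))"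
  by (induction S rule: infinite_finite_induct) (auto simp: hom_add)

lemma hom_of_nat: "\<psi> (of_nat n) = of_nat n"
  by (induction n) (auto simp: hom_add)

lemma CHAR_eq: "CHAR('k) = CHAR('f)"
proof (rule dvd_antisym)
  show "CHAR('k) dvd CHAR('f)"
    unfolding of_nat_eq_0_iff_char_dvd[symmetric, where 'a = 'k] by (simp flip: hom_of_nat)
  have "of_nat CHAR('k) = (0 :: 'k)" by simp
  then have "of_nat CHAR('k) = (0 :: 'f)" unfolding hom_of_nat[symmetric] hom_eq_0_iff .
  then show "CHAR('f) dvd CHAR('k)" by (simp add: of_nat_eq_0_iff_char_dvd)
qed

text \<open>The same choice of basis as inside \<open>ext_trace\<close>, so the trace unfolds into
  coordinates without a change of basis.\<close>

definition B :: "nat \<Rightarrow> 'k" where "B = (SOME b. is_basis \<psi> d b)"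

definition crd :: "'k \<Rightarrow> nat \<Rightarrow> 'f" where "crd = coord \<psi> d B"

definition tr :: "'k \<Rightarrow> 'f" where "tr = ext_trace \<psi> d"

lemma basis_B: "is_basis \<psi> d B"
  unfolding B_def using deg unfolding ext_degree_def by (rule someI_ex)

lemma tr_eq: "tr x = (\<Sum>i<d. crd (x * B i) i)"
  unfolding tr_def ext_trace_def crd_def B_def by (simp add: Let_def)

lemma crd_expand: "y = (\<Sum>i<d. \<psi> (crd y i) * B i)"
proof -
  have "\<exists>!c. (\<forall>i\<ge>d. c i = 0) \<and> y = (\<Sum>i<d. \<psi> (c i) * B i)"
    using basis_B unfolding is_basis_def by blast
  from theI'[OF this] show ?thesis unfolding crd_def coord_def by blast
qed

lemma crd_unique:
  assumes y: "y = (\<Sum>i<d. \<psi> (c i) * B i)" and i: "i < d"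
  shows "crd y i = c i"
proof -
  let ?Q = "\<lambda>c. (\<forall>i\<ge>d. c i = 0) \<and> y = (\<Sum>i<d. \<psi> (c i) * B i)"
  have ex1: "\<exists>!c. ?Q c" using basis_B unfolding is_basis_def by blast
  define c' where "c' i = (if i < d then c i else 0)" for i
  have "?Q c'" unfolding c'_def using y by (auto intro!: sum.cong)
  then have "(THE c. ?Q c) = c'" using ex1 by (intro the1_equality)
  then show ?thesis unfolding crd_def coord_def using i by (simp add: c'_def)
qed

lemma crd_add: "i < d \<Longrightarrow> crd (x + y) i = crd x i + crd y i"
proof (rule crd_unique)
  show "x + y = (\<Sum>i<d. \<psi> (crd x i + crd y i) * B i)"
    by (subst crd_expand[of x], subst crd_expand[of y]) (simp add: hom_add algebra_simps sum.distrib)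
qed

lemma crd_scale: "i < d \<Longrightarrow> crd (\<psi> c * x) i = c * crd x i"
proof (rule crd_unique)
  show "\<psi> c * x = (\<Sum>i<d. \<psi> (c * crd x i) * B i)"
    by (subst crd_expand[of x]) (simp add: hom_mult sum_distrib_left mult.assoc)
qed

lemma crd_0: "i < d \<Longrightarrow> crd 0 i = 0"
  by (rule crd_unique[of _ "\<lambda>_. 0"]) auto

lemma crd_sum: "i < d \<Longrightarrow> crd (sum f S) i = (\<Sum>j\<in>S. crd (f j) i)"
  by (induction S rule: infinite_finite_induct) (auto simp: crd_0 crd_add)

lemma crd_B: "i < d \<Longrightarrow> j < d \<Longrightarrow> crd (B j) i = (if i = j then 1 else 0)"
  by (rule crd_unique[of _ "\<lambda>i. if i = j then 1 else 0"]) (auto simp: if_distrib if_distribR cong: if_cong)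

lemma crd_mult:
  assumes "i < d"
  shows "crd (x * y) i = (\<Sum>k<d. crd (x * B k) i * crd y k)"
proof -
  have "x * y = x * (\<Sum>k<d. \<psi> (crd y k) * B k)" by (subst crd_expand[of y]) simp
  also have "\<dots> = (\<Sum>k<d. \<psi> (crd y k) * (x * B k))" by (simp add: sum_distrib_left algebra_simps)
  finally have e: "x * y = (\<Sum>k<d. \<psi> (crd y k) * (x * B k))" .
  show ?thesis
    unfolding e crd_sum[OF assms] crd_scale[OF assms] by (intro sum.cong refl mult.commute)
qed

lemma tr_add: "tr (x + y) = tr x + tr y"
  by (simp add: tr_eq crd_add distrib_right sum.distrib)

lemma tr_scale: "tr (\<psi> c * x) = c * tr x"
  by (simp add: tr_eq crd_scale mult.assoc sum_distrib_left)

lemma tr_0: "tr 0 = 0"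
  by (simp add: tr_eq crd_0)

lemma tr_sum: "tr (sum f S) = (\<Sum>i\<in>S. tr (f i))"
  by (induction S rule: infinite_finite_induct) (auto simp: tr_0 tr_add)

text \<open>The matrix of multiplication by \<open>f\<close> on \<open>K[X]\<close> over
  \<open>F[X]\<close> in the basis \<open>B\<close>, taken coefficient by coefficient. Its
  determinant is the norm of \<open>f\<close>.\<close>

definition M :: "'k poly \<Rightarrow> 'f poly mat" where
  "M f = mat d d (\<lambda>(i, j). map_poly (\<lambda>y. crd (y * B j) i) f)"

lemma M_carrier: "M f \<in> carrier_mat d d"
  by (simp add: M_def)

lemma M_mult: "M (f * g) = M f * M g"
proof (rule eq_matI)
  fix i j assume "i < dim_row (M f * M g)" "j < dim_col (M f * M g)"
  then have ij: "i < d" "j < d" by (auto simp: M_def)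
  have "M (f * g) $$ (i, j) = (\<Sum>k<d. M f $$ (i, k) * M g $$ (k, j))"
  proof (rule poly_eqI)
    fix n
    have "coeff (M (f * g) $$ (i, j)) n = crd ((\<Sum>l\<le>n. coeff f l * coeff g (n - l)) * B j) i"
      using ij by (simp add: M_def coeff_map_poly crd_0 coeff_mult)
    also have "\<dots> = (\<Sum>l\<le>n. crd (coeff f l * (coeff g (n - l) * B j)) i)"
      using ij by (simp add: sum_distrib_right crd_sum mult.assoc)
    also have "\<dots> = (\<Sum>l\<le>n. \<Sum>k<d. crd (coeff f l * B k) i * crd (coeff g (n - l) * B j) k)"
      by (intro sum.cong refl crd_mult ij)
    also have "\<dots> = (\<Sum>k<d. \<Sum>l\<le>n. crd (coeff f l * B k) i * crd (coeff g (n - l) * B j) k)"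
      by (rule sum.swap)
    also have "\<dots> = coeff (\<Sum>k<d. M f $$ (i, k) * M g $$ (k, j)) n"
      using ij by (simp add: M_def coeff_sum coeff_mult coeff_map_poly crd_0)
    finally show "coeff (M (f * g) $$ (i, j)) n = coeff (\<Sum>k<d. M f $$ (i, k) * M g $$ (k, j)) n" .
  qed
  also have "\<dots> = (M f * M g) $$ (i, j)"
    using ij by (simp add: M_def scalar_prod_def atLeast0LessThan)
  finally show "M (f * g) $$ (i, j) = (M f * M g) $$ (i, j)" .
qed (auto simp: M_def)

text \<open>The exponent is \<open>Suc n\<close> so that the induction starts at \<open>M f\<close>
  itself.\<close>

lemma det_M_power: "det (M (f ^ Suc n)) = det (M f) ^ Suc n"
proof (induction n)
  case (Suc n)
  have "det (M (f * f ^ Suc n)) = det (M f) * det (M f) ^ Suc n"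
    unfolding M_mult det_mult[OF M_carrier M_carrier] Suc.IH ..
  then show ?case by simp
qed simp

text \<open>The matrix of 1 is the identity since \<open>B\<close> is a basis, so the first-order
  coefficient is the matrix trace of multiplication by \<open>x\<close>, which is
  \<open>tr x\<close>.\<close>

lemma det_M_one_plus_monom:
  assumes "m > 0"
  shows "\<exists>h. det (M (1 + monom x m)) = 1 + monom (tr x) m + monom 1 (2 * m) * h"
proof -
  have "M (1 + monom x m)
      = mat d d (\<lambda>(i, j). (if i = j then 1 else 0) + monom (crd (x * B j) i) m)"
    (is "_ = ?R")
  proof (rule eq_matI)
    fix i j assume "i < dim_row ?R" "j < dim_col ?R"
    then have ij: "i < d" "j < d" by auto
    have "map_poly (\<lambda>y. crd (y * B j) i) (1 + monom x m)
      = (if i = j then 1 else 0) + monom (crd (x * B j) i) m"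
      using ij assms
      by (intro poly_eqI) (auto simp: coeff_map_poly crd_0 crd_B crd_add distrib_right)
    then show "M (1 + monom x m) $$ (i, j) = ?R $$ (i, j)" using ij by (simp add: M_def)
  qed (simp_all add: M_def)
  then show ?thesis using det_one_plus_monom[of d "\<lambda>i j. crd (x * B j) i" m] by (simp add: tr_eq)
qed

text \<open>The norm of \<open>1 + x X\<close> from \<open>K[X]\<close> to \<open>F[X]\<close> is \<open>1 + tr(x) X + \<dots>\<close>; raising it to the
  \<open>p\<close>-th power and comparing coefficients of \<open>X\<^sup>p\<close> gives the claim.\<close>

lemma tr_frobenius:
  assumes p: "prime CHAR('f)"
  shows "tr (x ^ CHAR('f)) = tr x ^ CHAR('f)"
proof -
  let ?p = "CHAR('f)"
  have p0: "?p > 0" using p prime_gt_0_nat by blast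
  then obtain n where n: "?p = Suc n" by (cases ?p) auto
  have pk: "prime CHAR('k poly)" "?p = CHAR('k poly)" using p CHAR_eq by simp_all
  have pf: "prime CHAR('f poly)" "?p = CHAR('f poly)" using p by simp_all
  have "(1 + monom x 1) ^ ?p = 1 + monom (x ^ ?p) ?p"
    using freshmans_dream[OF pk, of 1 "monom x 1"] by (simp add: monom_power)
  then have "det (M (1 + monom (x ^ ?p) ?p)) = det (M (1 + monom x 1)) ^ ?p"
    using det_M_power[of "1 + monom x 1" n] n by simp
  moreover obtain h where "det (M (1 + monom x 1)) = 1 + monom (tr x) 1 + monom 1 2 * h"
    using det_M_one_plus_monom[of 1 x] by auto
  moreover obtain h' where "det (M (1 + monom (x ^ ?p) ?p)) = 1 + monom (tr (x ^ ?p)) ?p + monom 1 (2 * ?p) * h'"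
    using det_M_one_plus_monom[OF p0] by blast
  ultimately have "1 + monom (tr (x ^ ?p)) ?p + monom 1 (2 * ?p) * h' = (1 + monom (tr x) 1 + monom 1 2 * h) ^ ?p"
    by simp
  \<comment> \<open>The error term is raised to the power as well, so it starts at degree
    \<open>2 * ?p\<close> and stays clear of the coefficient compared below.\<close>
  also have "\<dots> = 1 + monom (tr x ^ ?p) ?p + monom 1 (2 * ?p) * h ^ ?p"
    by (simp add: freshmans_dream[OF pf] monom_power power_mult_distrib)
  finally have eq: "1 + monom (tr (x ^ ?p)) ?p + monom 1 (2 * ?p) * h'
    = 1 + monom (tr x ^ ?p) ?p + monom 1 (2 * ?p) * h ^ ?p" .
  show ?thesis using arg_cong[OF eq, of "\<lambda>q. coeff q ?p"] p0 by (simp add: coeff_monom_mult)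
qed

lemma tr_frobenius_power:
  assumes p: "prime CHAR('f)"
  shows "tr (x ^ (CHAR('f) ^ r)) = tr x ^ (CHAR('f) ^ r)"
proof (induction r)
  case (Suc r)
  have "tr ((x ^ (CHAR('f) ^ r)) ^ CHAR('f)) = tr x ^ (CHAR('f) ^ r * CHAR('f))"
    unfolding tr_frobenius[OF p] Suc.IH by (simp add: power_mult)
  then show ?case by (simp add: power_mult[symmetric] mult.commute)
qed simp

end

section \<open>Integral elements\<close>

lemma embed_0 [simp]: "embed 0 = 0"
  and embed_1 [simp]: "embed 1 = 1"
  by (auto simp: embed_def Zero_fract_def One_fract_def)

lemma embed_add: "embed (x + y) = embed x + embed y"
  and embed_mult: "embed (x * y) = embed x * embed y"
  by (auto simp: embed_def)

lemma embed_eq_iff [simp]: "embed x = embed y \<longleftrightarrow> x = y"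
  by (auto simp: embed_def eq_fract)

lemma embed_eq_0_iff [simp]: "embed x = 0 \<longleftrightarrow> x = 0"
  using embed_eq_iff[of x 0] by (simp del: embed_eq_iff)

lemma embed_diff: "embed (x - y) = embed x - embed y"
  using embed_add[of "x - y" y] by (simp add: algebra_simps)

lemma embed_power: "embed (x ^ n) = embed x ^ n"
  by (induction n) (auto simp: embed_mult)

lemma embed_of_nat: "embed (of_nat n) = of_nat n"
  by (induction n) (auto simp: embed_add)

lemma embed_sum: "embed (sum f S) = (\<Sum>i\<in>S. embed (f i))"
  by (induction S rule: infinite_finite_induct) (auto simp: embed_add)

text \<open>A positive characteristic of a domain is prime. It is positive here because the finite
  coefficient field has positive characteristic and \<open>of_nat\<close> passes through
  \<open>embed\<close>.\<close>

lemma prime_CHAR_fract: "prime CHAR('a::{finite,field} poly fract)"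
proof (rule prime_CHAR_semidom)
  have pos: "CHAR('a) > 0" by (rule finite_imp_CHAR_pos) (rule finite)
  have "of_nat CHAR('a poly) = (0 :: 'a poly)" by (rule of_nat_CHAR)
  then have "embed (of_nat CHAR('a) :: 'a poly) = 0" by (simp only: embed_0 semiring_char_poly)
  then have "of_nat CHAR('a) = (0 :: 'a poly fract)" by (simp only: embed_of_nat)
  then have "CHAR('a poly fract) dvd CHAR('a)" by (simp only: of_nat_eq_0_iff_char_dvd)
  then show "CHAR('a poly fract) > 0" using pos by (rule dvd_pos_nat[rotated])
qed

lemma range_embed_sum:
  assumes "\<And>i. i \<in> S \<Longrightarrow> f i \<in> range embed"
  shows "sum f S \<in> range embed"
proof -
  have "\<exists>g. \<forall>i\<in>S. f i = embed (g i)" using assms by (intro bchoice) auto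
  then obtain g where "\<forall>i\<in>S. f i = embed (g i)" ..
  then have "sum f S = embed (sum g S)" by (simp add: embed_sum)
  then show ?thesis by blast
qed

lemma common_denominator:
  fixes f :: "nat \<Rightarrow> 'b::idom fract"
  shows "\<exists>w. w \<noteq> 0 \<and> (\<forall>i<n. embed w * f i \<in> range embed)"
proof (induction n)
  case 0
  show ?case by (intro exI[of _ 1]) auto
next
  case (Suc n)
  then obtain w where w: "w \<noteq> 0" "\<And>i. i < n \<Longrightarrow> embed w * f i \<in> range embed" by blast
  obtain a b where ab: "f n = Fract a b" "b \<noteq> 0" by (cases "f n")
  have fn: "embed b * f n = embed a" using ab by (simp add: embed_def eq_fract mult.commute)
  have "embed (b * w) * f i \<in> range embed" if i: "i < Suc n" for i
  proof (cases "i = n")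
    case True
    have "embed (b * w) * f n = embed w * (embed b * f n)" by (simp add: embed_mult algebra_simps)
    also have "\<dots> = embed (w * a)" unfolding fn by (simp add: embed_mult)
    finally show ?thesis using True by auto
  next
    case False
    then obtain e where "embed w * f i = embed e" using w(2)[of i] i by auto
    then have "embed (b * w) * f i = embed (b * e)" by (simp add: embed_mult mult.assoc)
    then show ?thesis by auto
  qed
  then show ?case using w(1) ab(2) by (intro exI[of _ "b * w"]) auto
qed

section \<open>The integral closure as a ring\<close>

locale function_field = field_ext \<psi> d
  for \<psi> :: "'a::{finite,field} poly fract \<Rightarrow> 'k::field" and d :: nat
begin

definition \<phi> :: "'a poly \<Rightarrow> 'k" where "\<phi> a = \<psi> (embed a)"

lemma phi_simps [simp]: "\<phi> 0 = 0" "\<phi> 1 = 1" "\<phi> x = 0 \<longleftrightarrow> x = 0"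
  and phi_add: "\<phi> (x + y) = \<phi> x + \<phi> y"
  and phi_mult: "\<phi> (x * y) = \<phi> x * \<phi> y"
  and phi_diff: "\<phi> (x - y) = \<phi> x - \<phi> y"
  and phi_eq_iff: "\<phi> x = \<phi> y \<longleftrightarrow> x = y"
  by (auto simp: \<phi>_def embed_add embed_mult embed_diff hom_add hom_mult hom_diff)

lemma phi_sum: "\<phi> (sum f S) = (\<Sum>i\<in>S. \<phi> (f i))"
  by (simp add: \<phi>_def embed_sum hom_sum)

lemma phi_power: "\<phi> (x ^ n) = \<phi> x ^ n"
  by (induction n) (auto simp: phi_mult)

sublocale phi: comm_ring_hom \<phi>
  by unfold_locales (auto simp: phi_add phi_mult)

abbreviation ringO :: "'k set" (\<open>\<O>\<close>) where "\<O> \<equiv> OK \<psi>"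

lemma OK_iff: "x \<in> \<O> \<longleftrightarrow> (\<exists>f :: 'a poly poly. lead_coeff f = 1 \<and> poly (map_poly \<phi> f) x = 0)"
  unfolding OK_def \<phi>_def by (simp add: comp_def)

lemma integral_relation:
  assumes "x \<in> \<O>"
  obtains n c where "x ^ n = (\<Sum>i<n. \<phi> (c i) * x ^ i)"
proof -
  from assms obtain f :: "'a poly poly" where f: "lead_coeff f = 1" "poly (map_poly \<phi> f) x = 0"
    by (auto simp: OK_iff)
  define n where "n = degree f"
  have "degree (map_poly \<phi> f) = n" unfolding n_def by (rule degree_map_poly) simp
  then have "0 = (\<Sum>i\<le>n. \<phi> (coeff f i) * x ^ i)"
    using f(2) by (simp add: poly_altdef coeff_map_poly)
  also have "\<dots> = (\<Sum>i<n. \<phi> (coeff f i) * x ^ i) + x ^ n"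
    using f(1) by (simp add: lessThan_Suc_atMost[symmetric] n_def)
  finally have "x ^ n = - (\<Sum>i<n. \<phi> (coeff f i) * x ^ i)" by (simp add: eq_neg_iff_add_eq_0 add.commute)
  also have "\<dots> = (\<Sum>i<n. \<phi> (- coeff f i) * x ^ i)" by (simp add: phi.hom_uminus sum_negf)
  finally show ?thesis by (rule that)
qed

definition spn :: "(nat \<Rightarrow> 'k) \<Rightarrow> nat \<Rightarrow> 'k set" where
  "spn e n = {(\<Sum>i<n. \<phi> (c i) * e i) | c. True}"

lemma spn_iff: "y \<in> spn e n \<longleftrightarrow> (\<exists>c. y = (\<Sum>i<n. \<phi> (c i) * e i))"
  by (simp add: spn_def)

lemma spn_intro: "(\<Sum>i<n. \<phi> (c i) * e i) \<in> spn e n"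
  unfolding spn_iff by blast

lemma spn_zero: "0 \<in> spn e n"
  unfolding spn_iff by (intro exI[of _ "\<lambda>_. 0"]) simp

lemma spn_add:
  assumes "x \<in> spn e n" "y \<in> spn e n"
  shows "x + y \<in> spn e n"
proof -
  from assms obtain a b where "x = (\<Sum>i<n. \<phi> (a i) * e i)" "y = (\<Sum>i<n. \<phi> (b i) * e i)"
    unfolding spn_iff by blast
  then have "x + y = (\<Sum>i<n. \<phi> (a i + b i) * e i)" by (simp add: phi_add distrib_right sum.distrib)
  then show ?thesis by (simp only: spn_intro[of "\<lambda>i. a i + b i"])
qed

lemma spn_scale:
  assumes "x \<in> spn e n"
  shows "\<phi> c * x \<in> spn e n"
proof -
  from assms obtain a where "x = (\<Sum>i<n. \<phi> (a i) * e i)" unfolding spn_iff by blast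
  then have "\<phi> c * x = (\<Sum>i<n. \<phi> (c * a i) * e i)" by (simp add: phi_mult sum_distrib_left mult.assoc)
  then show ?thesis by (simp only: spn_intro[of "\<lambda>i. c * a i"])
qed

lemma spn_diff: "x \<in> spn e n \<Longrightarrow> y \<in> spn e n \<Longrightarrow> x - y \<in> spn e n"
  using spn_add[of x e n "- y"] spn_scale[of y e n "- 1"] by (simp add: phi.hom_uminus)

lemma spn_sum: "(\<And>i. i \<in> S \<Longrightarrow> f i \<in> spn e n) \<Longrightarrow> sum f S \<in> spn e n"
  by (induction S rule: infinite_finite_induct) (auto simp: spn_zero spn_add)

lemma spn_gen: "k < n \<Longrightarrow> e k \<in> spn e n"
  unfolding spn_iff
  by (intro exI[of _ "\<lambda>i. if i = k then 1 else 0"])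
    (auto simp: if_distrib if_distribR cong: if_cong)

lemma spn_mult_closed:
  assumes "\<And>k. k < n \<Longrightarrow> z * e k \<in> spn e n" and "s \<in> spn e n"
  shows "z * s \<in> spn e n"
proof -
  from assms(2) obtain c where c: "s = (\<Sum>i<n. \<phi> (c i) * e i)" unfolding spn_iff by blast
  have "z * s = (\<Sum>i<n. \<phi> (c i) * (z * e i))" unfolding c by (simp add: sum_distrib_left algebra_simps)
  then show ?thesis using assms(1) by (auto intro!: spn_sum spn_scale)
qed

text \<open>The determinant trick: the vector of generators is a nonzero eigenvector, with
  eigenvalue \<open>z\<close>, of the matrix describing multiplication by \<open>z\<close>. So
  \<open>z\<close> is a root of a characteristic polynomial, which is monic with coefficients in
  \<open>F_q[t]\<close>.\<close>

lemma integral_if_stabilizes: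
  assumes st: "\<And>k. k < n \<Longrightarrow> z * e k \<in> spn e n" and k: "k < n" "e k \<noteq> 0"
  shows "z \<in> \<O>"
proof -
  have "\<forall>k\<in>{..<n}. \<exists>c. z * e k = (\<Sum>i<n. \<phi> (c i) * e i)" using st unfolding spn_iff by auto
  from bchoice[OF this] obtain C where C: "\<And>k. k < n \<Longrightarrow> z * e k = (\<Sum>i<n. \<phi> (C k i) * e i)"
    by auto
  define A where "A = mat n n (\<lambda>(k, i). C k i)"
  have A: "A \<in> carrier_mat n n" by (simp add: A_def)
  let ?A = "map_mat \<phi> A" and ?v = "vec n e"
  have "?A *\<^sub>v ?v = z \<cdot>\<^sub>v ?v"
    by (rule eq_vecI) (auto simp: A_def scalar_prod_def C atLeast0LessThan)
  moreover have "?v \<noteq> 0\<^sub>v n"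
  proof
    assume "?v = 0\<^sub>v n"
    then have "?v $ k = 0\<^sub>v n $ k" by simp
    with k show False by simp
  qed
  ultimately have "eigenvalue ?A z"
    unfolding eigenvalue_def eigenvector_def using A by (intro exI[of _ ?v]) auto
  then have "poly (char_poly ?A) z = 0" using eigenvalue_root_char_poly[of ?A n] A by simp
  then have "poly (map_poly \<phi> (char_poly A)) z = 0" by (simp add: phi.char_poly_hom[OF A])
  then show ?thesis unfolding OK_iff using degree_monic_char_poly[OF A] by auto
qed

text \<open>The module generated by the \<open>x ^ i * y ^ j\<close> with \<open>i < m\<close> and
  \<open>j < n\<close> is stable under \<open>x\<close> and under \<open>y\<close>, hence under
  their difference and product.\<close>

lemma OK_closed:
  assumes x: "x \<in> \<O>" and y: "y \<in> \<O>"
  shows OK_diff: "x - y \<in> \<O>" and OK_mult: "x * y \<in> \<O>"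
proof -
  from x obtain m a where a: "x ^ m = (\<Sum>i<m. \<phi> (a i) * x ^ i)" by (rule integral_relation)
  from y obtain n b where b: "y ^ n = (\<Sum>i<n. \<phi> (b i) * y ^ i)" by (rule integral_relation)
  \<comment> \<open>A relation with no terms on the right would read \<open>1 = 0\<close>.\<close>
  have m0: "m > 0" and n0: "n > 0" using a b by (cases m; cases n; simp)+
  \<comment> \<open>The pair of exponents is coded as \<open>k = i * n + j\<close>, to list the
    generators by a single index.\<close>
  define e where "e k = x ^ (k div n) * y ^ (k mod n)" for k
  let ?S = "spn e (m * n)"
  have gen: "x ^ i * y ^ j \<in> ?S" if "i < m" "j < n" for i j
  proof -
    have "i * n + j < Suc i * n" using that by simp
    also have "\<dots> \<le> m * n" using that by (intro mult_le_mono1) simp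
    finally have "i * n + j < m * n" .
    moreover have "e (i * n + j) = x ^ i * y ^ j" using that by (simp add: e_def)
    ultimately show ?thesis using spn_gen[of "i * n + j" "m * n" e] by simp
  qed
  have ij: "k div n < m" "k mod n < n" if "k < m * n" for k
    using that n0 by (auto simp: less_mult_imp_div_less)
  have stx: "x * e k \<in> ?S" if k: "k < m * n" for k
  proof (cases "Suc (k div n) < m")
    case True
    then show ?thesis using gen[OF True ij(2)[OF k]] by (simp add: e_def mult.assoc)
  next
    case False
    then have "Suc (k div n) = m" using ij[OF k] by simp
    then have "x * e k = x ^ m * y ^ (k mod n)" by (auto simp: e_def mult.assoc)
    also have "\<dots> = (\<Sum>i<m. \<phi> (a i) * (x ^ i * y ^ (k mod n)))"
      unfolding a by (simp add: sum_distrib_right mult.assoc)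
    also have "\<dots> \<in> ?S" using ij[OF k] gen by (intro spn_sum spn_scale) auto
    finally show ?thesis .
  qed
  have sty: "y * e k \<in> ?S" if k: "k < m * n" for k
  proof (cases "Suc (k mod n) < n")
    case True
    then show ?thesis using gen[OF ij(1)[OF k] True] by (simp add: e_def mult.left_commute)
  next
    case False
    then have "Suc (k mod n) = n" using ij[OF k] by simp
    then have "y * e k = x ^ (k div n) * y ^ n"
      using power_Suc[of y "k mod n"] by (simp add: e_def mult.left_commute)
    also have "\<dots> = (\<Sum>i<n. \<phi> (b i) * (x ^ (k div n) * y ^ i))"
      unfolding b by (simp add: sum_distrib_left algebra_simps)
    also have "\<dots> \<in> ?S" using ij[OF k] gen by (intro spn_sum spn_scale) auto
    finally show ?thesis .
  qed
  have e0: "e 0 \<noteq> 0" "0 < m * n" using m0 n0 by (auto simp: e_def)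
  show "x - y \<in> \<O>"
    by (rule integral_if_stabilizes[of "m * n" _ e, OF _ e0(2,1)])
      (simp add: left_diff_distrib spn_diff stx sty)
  show "x * y \<in> \<O>"
    by (rule integral_if_stabilizes[of "m * n" _ e, OF _ e0(2,1)])
      (simp add: mult.assoc spn_mult_closed[OF stx] sty)
qed

lemma phi_in_OK: "\<phi> a \<in> \<O>"
  by (rule integral_if_stabilizes[of 1 _ "\<lambda>_. 1" 0]) (auto simp: spn_iff)

lemma OK_subring: "is_subring \<O>"
  using phi_in_OK[of 0] phi_in_OK[of 1]
  by (auto simp: is_subring_def add_subgroup_def OK_diff OK_mult)

lemma OK_group: "add_subgroup \<O>"
  using OK_subring by (simp add: is_subring_def)

lemma OK_power: "x \<in> \<O> \<Longrightarrow> x ^ n \<in> \<O>"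
  by (rule is_subring_power[OF OK_subring])

text \<open>Multiply the integral relation of \<open>y\<close> by \<open>u ^ n\<close>: the left
  side becomes 1, and each term on the right keeps a factor \<open>u\<close> because its power of
  \<open>y\<close> is below \<open>n\<close>.\<close>

lemma OK_phi_unit:
  assumes "y \<in> \<O>" "\<phi> u * y = 1"
  shows "is_unit u"
proof -
  from assms(1) obtain n c where c: "y ^ n = (\<Sum>i<n. \<phi> (c i) * y ^ i)" by (rule integral_relation)
  have pw: "\<phi> u ^ k * y ^ k = 1" for k using assms(2) by (simp flip: power_mult_distrib)
  have "1 = \<phi> u ^ n * y ^ n" using pw by simp
  also have "\<dots> = (\<Sum>i<n. \<phi> (c i) * (\<phi> u ^ n * y ^ i))" unfolding c by (simp add: sum_distrib_left algebra_simps)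
  also have "\<dots> = (\<Sum>i<n. \<phi> (u * (u ^ (n - 1 - i) * c i)))"
  proof (rule sum.cong[OF refl])
    fix i assume "i \<in> {..<n}"
    then have "n = Suc (n - 1 - i) + i" by auto
    then have "\<phi> u ^ n * y ^ i = \<phi> u ^ Suc (n - 1 - i) * (\<phi> u ^ i * y ^ i)"
      by (metis power_add mult.assoc)
    then show "\<phi> (c i) * (\<phi> u ^ n * y ^ i) = \<phi> (u * (u ^ (n - 1 - i) * c i))"
      by (simp add: pw phi_mult phi_power)
  qed
  also have "\<dots> = \<phi> (u * (\<Sum>i<n. u ^ (n - 1 - i) * c i))" by (simp add: phi_sum sum_distrib_left)
  finally have "\<phi> (u * (\<Sum>i<n. u ^ (n - 1 - i) * c i)) = \<phi> 1" by simp
  then show ?thesis unfolding phi_eq_iff by (metis dvdI)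
qed

text \<open>The powers of \<open>x\<close> lie in a finitely generated module, so their traces have a common
  denominator; along the exponents \<open>p\<^sup>r\<close> these traces are the powers of the trace of \<open>x\<close>.\<close>

lemma tr_integral:
  assumes "x \<in> \<O>"
  shows "tr x \<in> range embed"
proof -
  from assms obtain n c where c: "x ^ n = (\<Sum>i<n. \<phi> (c i) * x ^ i)" by (rule integral_relation)
  let ?S = "spn (\<lambda>i. x ^ i) n"
  have n0: "n > 0" using c by (cases n) auto
  have st: "x * x ^ k \<in> ?S" if "k < n" for k
  proof (cases "Suc k < n")
    case True
    then show ?thesis using spn_gen[of "Suc k" n "\<lambda>i. x ^ i"] by simp
  next
    case False
    then have "n = Suc k" using that by simp
    then have "x * x ^ k = x ^ n" by simp
    then show ?thesis unfolding c by (simp only: spn_intro)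
  qed
  have all: "x ^ k \<in> ?S" for k
  proof (induction k)
    case 0
    then show ?case using spn_gen[OF n0, of "\<lambda>i. x ^ i"] by simp
  next
    case (Suc k)
    then show ?case using spn_mult_closed[of n x "\<lambda>i. x ^ i", OF st] by simp
  qed
  obtain w where w: "w \<noteq> 0" "\<And>i. i < n \<Longrightarrow> embed w * tr (x ^ i) \<in> range embed"
    using common_denominator[of n "\<lambda>i. tr (x ^ i)"] by blast
  have trw: "embed w * tr (x ^ k) \<in> range embed" for k
  proof -
    from all[of k] obtain a where a: "x ^ k = (\<Sum>i<n. \<phi> (a i) * x ^ i)" unfolding spn_iff by blast
    have "embed w * tr (x ^ k) = (\<Sum>i<n. embed (a i) * (embed w * tr (x ^ i)))"
      unfolding a \<phi>_def tr_sum tr_scale by (simp add: sum_distrib_left algebra_simps)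
    also have "\<dots> \<in> range embed"
    proof (rule range_embed_sum)
      fix i assume "i \<in> {..<n}"
      then obtain s where "embed w * tr (x ^ i) = embed s" using w(2) by blast
      then show "embed (a i) * (embed w * tr (x ^ i)) \<in> range embed" by (simp flip: embed_mult)
    qed
    finally show ?thesis .
  qed
  show ?thesis
  \<comment> \<open>The exponents \<open>?p ^ m\<close> are unbounded because
    \<open>m < 2 ^ m\<close> and \<open>?p\<close> is at least 2.\<close>
  proof (rule bounded_powers_imp_polynomial[OF w(1)])
    fix m :: nat
    let ?p = "CHAR('a poly fract)"
    have "?p \<ge> 2" using prime_CHAR_fract[where 'a = 'a] by (rule prime_ge_2_nat)
    then have "m \<le> ?p ^ m" using less_exp[of m] power_mono[of 2 ?p m] by linarith
    moreover have "embed w * tr x ^ (?p ^ m) \<in> range embed"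
      using trw[of "?p ^ m"] tr_frobenius_power[OF prime_CHAR_fract] by simp
    ultimately show "\<exists>n\<ge>m. embed w * tr x ^ n \<in> range embed" by blast
  qed
qed

text \<open>At a Frobenius exponent \<open>?p ^ n\<close>, which is at least \<open>n\<close>, the
  power of \<open>z\<close> is \<open>P\<close> times an integral element. Its trace is therefore
  divisible by \<open>P\<close>, and it is also a power of \<open>tr z\<close>; irreducibility
  brings the divisibility down to \<open>tr z\<close>.\<close>

lemma tr_nilpotent_mod:
  assumes P: "irreducible P" and z: "z \<in> \<O>" and y: "y \<in> \<O>" and zy: "z ^ n = \<phi> P * y"
  obtains t where "tr z = embed (P * t)"
proof -
  let ?p = "CHAR('a poly fract)"
  have "?p \<ge> 2" using prime_CHAR_fract[where 'a = 'a] by (rule prime_ge_2_nat)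
  then have le: "n \<le> ?p ^ n" using less_exp[of n] power_mono[of 2 ?p n] by linarith
  define y' where "y' = y * z ^ (?p ^ n - n)"
  have y': "y' \<in> \<O>" unfolding y'_def by (intro OK_mult y OK_power z)
  have "z ^ (?p ^ n) = z ^ n * z ^ (?p ^ n - n)" using le by (simp flip: power_add)
  then have "z ^ (?p ^ n) = \<psi> (embed P) * y'" unfolding zy y'_def by (simp add: mult.assoc \<phi>_def)
  then have e: "tr z ^ (?p ^ n) = embed P * tr y'"
    using tr_frobenius_power[OF prime_CHAR_fract, of z n] by (simp add: tr_scale)
  obtain s s' where s: "tr z = embed s" "tr y' = embed s'" using tr_integral z y' by blast
  have "embed (s ^ (?p ^ n)) = embed (P * s')" using e unfolding s by (simp add: embed_power embed_mult)
  then have "P dvd s ^ (?p ^ n)" by simp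
  then have "P dvd s" using irreducible_poly_dvd_power[OF P] by blast
  then show ?thesis using s(1) that by (auto elim!: dvdE)
qed

end

section \<open>Unramified primes\<close>

lemma adj_mat_sums:
  fixes A :: "'b::comm_ring_1 mat"
  assumes A: "A \<in> carrier_mat n n" and ij: "i < n" "j < n"
  shows "(\<Sum>k<n. A $$ (i, k) * adj_mat A $$ (k, j)) = (if i = j then det A else 0)"
    and "(\<Sum>k<n. adj_mat A $$ (i, k) * A $$ (k, j)) = (if i = j then det A else 0)"
proof -
  note adj = adj_mat[OF A]
  have "(\<Sum>k<n. A $$ (i, k) * adj_mat A $$ (k, j)) = (A * adj_mat A) $$ (i, j)"
    using A adj(1) ij by (simp add: scalar_prod_def atLeast0LessThan)
  then show "(\<Sum>k<n. A $$ (i, k) * adj_mat A $$ (k, j)) = (if i = j then det A else 0)"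
    unfolding adj(2) using ij by simp
  have "(\<Sum>k<n. adj_mat A $$ (i, k) * A $$ (k, j)) = (adj_mat A * A) $$ (i, j)"
    using A adj(1) ij by (simp add: scalar_prod_def atLeast0LessThan)
  then show "(\<Sum>k<n. adj_mat A $$ (i, k) * A $$ (k, j)) = (if i = j then det A else 0)"
    unfolding adj(3) using ij by simp
qed

context function_field
begin

abbreviation multiples :: "'a poly \<Rightarrow> 'k set" where "multiples r \<equiv> (*) (\<phi> r) ` \<O>"

lemma multiples_ideal: "is_ideal \<O> (multiples r)"
  unfolding is_ideal_def add_subgroup_def
proof (intro conjI ballI)
  have "\<phi> r * 0 \<in> multiples r" by (rule imageI) (rule add_subgroup_zero[OF OK_group])
  then show "0 \<in> multiples r" by simp
next
  fix x y assume "x \<in> multiples r" "y \<in> multiples r"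
  then obtain u v where uv: "x = \<phi> r * u" "y = \<phi> r * v" "u \<in> \<O>" "v \<in> \<O>" by auto
  then have "x - y = \<phi> r * (u - v)" by (simp add: right_diff_distrib)
  then show "x - y \<in> multiples r" using OK_diff[OF uv(3,4)] by blast
next
  show "multiples r \<subseteq> \<O>" using phi_in_OK OK_mult by auto
next
  fix s x assume "s \<in> \<O>" "x \<in> multiples r"
  then obtain u where u: "x = \<phi> r * u" "u \<in> \<O>" "s * u \<in> \<O>" using OK_mult by auto
  then have "s * x = \<phi> r * (s * u)" by (simp add: mult.left_commute)
  then show "s * x \<in> multiples r" using u by blast
qed

section \<open>Indices of modules obtained by adjoining generators\<close>

definition submodule :: "'k set \<Rightarrow> bool" where
  "submodule J \<longleftrightarrow> add_subgroup J \<and> (\<forall>c. \<forall>j\<in>J. \<phi> c * j \<in> J)"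

lemma ideal_submodule: "is_ideal \<O> I \<Longrightarrow> submodule I"
  unfolding is_ideal_def submodule_def using phi_in_OK by blast

definition adjoin :: "'k set \<Rightarrow> 'k \<Rightarrow> 'k set" where
  "adjoin J x = {j + \<phi> c * x | j c. j \<in> J}"

lemma adjoin_submodule:
  assumes J: "submodule J"
  shows "submodule (adjoin J x)"
proof -
  have J': "add_subgroup J" "\<And>c j. j \<in> J \<Longrightarrow> \<phi> c * j \<in> J" using J by (auto simp: submodule_def)
  show ?thesis
    unfolding submodule_def add_subgroup_def
  proof (intro conjI ballI allI)
    show "0 \<in> adjoin J x"
      unfolding adjoin_def using add_subgroup_zero[OF J'(1)]
      by (intro CollectI exI[of _ 0]) auto
  next
    fix u v assume "u \<in> adjoin J x" "v \<in> adjoin J x"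
    then obtain i c j e where *: "u = i + \<phi> c * x" "v = j + \<phi> e * x" "i \<in> J" "j \<in> J"
      unfolding adjoin_def by blast
    then have "u - v = (i - j) + \<phi> (c - e) * x" by (simp add: phi_diff algebra_simps)
    then show "u - v \<in> adjoin J x" unfolding adjoin_def using add_subgroup_diff[OF J'(1) *(3,4)] by blast
  next
    fix s u assume "u \<in> adjoin J x"
    then obtain i c where *: "u = i + \<phi> c * x" "i \<in> J" unfolding adjoin_def by blast
    then have "\<phi> s * u = \<phi> s * i + \<phi> (s * c) * x" by (simp add: phi_mult algebra_simps)
    then show "\<phi> s * u \<in> adjoin J x" unfolding adjoin_def using J'(2)[OF *(2)] by blast
  qed
qed

lemma adjoin_superset: "J \<subseteq> adjoin J x"
proof
  fix j assume "j \<in> J"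
  then show "j \<in> adjoin J x" unfolding adjoin_def by (intro CollectI exI[of _ j] exI[of _ 0]) simp
qed

lemma adjoin_absorb:
  assumes J: "submodule J" and x: "x \<in> J"
  shows "adjoin J x = J"
proof
  have J': "add_subgroup J" "\<And>c j. j \<in> J \<Longrightarrow> \<phi> c * j \<in> J" using J by (auto simp: submodule_def)
  show "adjoin J x \<subseteq> J"
    unfolding adjoin_def using J'(2)[OF x] by (auto intro!: add_subgroup_add[OF J'(1)])
qed (rule adjoin_superset)

text \<open>Sending \<open>c\<close> to \<open>\<phi> c * x\<close> identifies
  \<open>F_q[t]/P\<close> with the quotient: by Bezout, a multiplier prime to \<open>P\<close> that
  takes \<open>x\<close> into \<open>J\<close> would put \<open>x\<close> itself into
  \<open>J\<close>. The remainders modulo \<open>P\<close> thus give a transversal.\<close>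

lemma has_index_adjoin:
  assumes P: "irreducible P" and J: "submodule J" and Px: "\<phi> P * x \<in> J" and x: "x \<notin> J"
  shows "has_index (adjoin J x) J (card (UNIV :: 'a set) ^ degree P)"
proof -
  have J': "add_subgroup J" "\<And>c j. j \<in> J \<Longrightarrow> \<phi> c * j \<in> J" using J by (auto simp: submodule_def)
  have cx: "P dvd c" if "\<phi> c * x \<in> J" for c
  proof (rule ccontr)
    assume "\<not> P dvd c"
    then obtain u v where uv: "u * c + v * P = 1" by (rule irreducible_poly_bezout[OF P])
    have "x = \<phi> (u * c + v * P) * x" unfolding uv by simp
    also have "\<dots> = \<phi> u * (\<phi> c * x) + \<phi> v * (\<phi> P * x)" by (simp add: phi_add phi_mult algebra_simps)
    also have "\<dots> \<in> J" by (rule add_subgroup_add[OF J'(1) J'(2)[OF that] J'(2)[OF Px]])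
    finally show False using x by simp
  qed
  have P0: "P \<noteq> 0" using P by auto
  let ?C = "{c :: 'a poly. c = 0 \<or> degree c < degree P}"
  let ?f = "\<lambda>c. \<phi> c * x"
  have sep: "c = e" if "c \<in> ?C" "e \<in> ?C" "?f c - ?f e \<in> J" for c e
  proof (rule ccontr)
    assume ne: "c \<noteq> e"
    have "?f (c - e) \<in> J" using that(3) by (simp add: phi_diff left_diff_distrib)
    then have "P dvd c - e" by (rule cx)
    then have "degree P \<le> degree (c - e)" using ne by (intro dvd_imp_degree_le) auto
    moreover have "degree (c - e) < degree P"
    proof (cases "c = 0 \<or> e = 0")
      case True
      then show ?thesis using that(1,2) ne by auto
    next
      case False
      then show ?thesis using that(1,2) by (intro degree_diff_less) auto
    qed
    ultimately show False by simp
  qed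
  have inj: "inj_on ?f ?C"
  proof (rule inj_onI)
    fix c e assume ce: "c \<in> ?C" "e \<in> ?C" "?f c = ?f e"
    show "c = e" by (rule sep[OF ce(1,2)]) (simp only: ce(3) diff_self add_subgroup_zero[OF J'(1)])
  qed
  have card: "finite ?C" "card ?C = card (UNIV :: 'a set) ^ degree P"
    using card_poly_bounded_degree[of "degree P", where 'a = 'a] by blast+
  show ?thesis
    unfolding has_index_def
  proof (intro exI[of _ "?f ` ?C"] conjI ballI impI)
    show "finite (?f ` ?C)" by (rule finite_imageI[OF card(1)])
    show "card (?f ` ?C) = card (UNIV :: 'a set) ^ degree P" using card(2) unfolding card_image[OF inj] .
    have "?f c \<in> adjoin J x" for c
      unfolding adjoin_def using add_subgroup_zero[OF J'(1)]
      by (intro CollectI exI[of _ 0] exI[of _ c]) auto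
    then show "?f ` ?C \<subseteq> adjoin J x" by (rule image_subsetI)
  next
    fix y assume "y \<in> adjoin J x"
    then obtain j c where jc: "y = j + \<phi> c * x" "j \<in> J" unfolding adjoin_def by blast
    have "\<phi> c = \<phi> (c div P * P + c mod P)" by (simp only: div_mult_mod_eq)
    then have c: "\<phi> c = \<phi> (c div P) * \<phi> P + \<phi> (c mod P)" by (simp only: phi_add phi_mult)
    have "y - ?f (c mod P) = j + \<phi> (c div P) * (\<phi> P * x)"
      unfolding jc(1) c by (simp only: distrib_right mult.assoc add_diff_cancel_right' add.assoc[symmetric])
    also have "\<dots> \<in> J" by (rule add_subgroup_add[OF J'(1) jc(2) J'(2)[OF Px]])
    finally have "y - ?f (c mod P) \<in> J" .
    moreover have "c mod P \<in> ?C" using degree_mod_less[OF P0, of c] by auto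
    ultimately show "\<exists>t\<in>?f ` ?C. y - t \<in> J" by (intro bexI[of _ "?f (c mod P)"] imageI)
  next
    fix t s assume t: "t \<in> ?f ` ?C" and s: "s \<in> ?f ` ?C" and ts: "t - s \<in> J"
    from t obtain c where c: "c \<in> ?C" "t = ?f c" by (rule imageE)
    from s obtain e where e: "e \<in> ?C" "s = ?f e" by (rule imageE)
    have "c = e" using sep[OF c(1) e(1)] ts unfolding c(2) e(2) .
    then show "t = s" using c e by simp
  qed
qed

primrec adjoin_list :: "'k set \<Rightarrow> (nat \<Rightarrow> 'k) \<Rightarrow> nat \<Rightarrow> 'k set" where
  "adjoin_list J a 0 = J"
| "adjoin_list J a (Suc s) = adjoin (adjoin_list J a s) (a s)"

lemma adjoin_list_submodule: "submodule J \<Longrightarrow> submodule (adjoin_list J a s)"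
  by (induction s) (auto intro: adjoin_submodule)

lemma adjoin_list_superset: "J \<subseteq> adjoin_list J a s"
  by (induction s) (simp_all add: subset_trans[OF _ adjoin_superset])

lemma adjoin_list_iff: "y \<in> adjoin_list J a s \<longleftrightarrow> (\<exists>j\<in>J. \<exists>c. y = j + (\<Sum>i<s. \<phi> (c i) * a i))"
proof (induction s arbitrary: y)
  case (Suc s)
  show ?case
  proof
    assume "y \<in> adjoin_list J a (Suc s)"
    then obtain z e where z: "y = z + \<phi> e * a s" "z \<in> adjoin_list J a s" unfolding adjoin_list.simps adjoin_def by blast
    then obtain j c where jc: "j \<in> J" "z = j + (\<Sum>i<s. \<phi> (c i) * a i)" using Suc.IH by blast
    have "y = j + (\<Sum>i<Suc s. \<phi> ((c(s := e)) i) * a i)" unfolding z jc by (simp add: add.assoc)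
    then show "\<exists>j\<in>J. \<exists>c. y = j + (\<Sum>i<Suc s. \<phi> (c i) * a i)" using jc(1) by blast
  next
    assume "\<exists>j\<in>J. \<exists>c. y = j + (\<Sum>i<Suc s. \<phi> (c i) * a i)"
    then obtain j c where jc: "j \<in> J" "y = j + (\<Sum>i<Suc s. \<phi> (c i) * a i)" by blast
    then have "y = (j + (\<Sum>i<s. \<phi> (c i) * a i)) + \<phi> (c s) * a s" by (simp add: add.assoc)
    moreover have "j + (\<Sum>i<s. \<phi> (c i) * a i) \<in> adjoin_list J a s" using Suc.IH jc(1) by blast
    ultimately show "y \<in> adjoin_list J a (Suc s)" unfolding adjoin_list.simps adjoin_def by blast
  qed
qed simp

text \<open>Adjoining a generator either changes nothing or multiplies the index by
  \<open>q ^ degree P\<close>; \<open>m\<close> counts the proper steps. The bound on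
  \<open>m\<close> will serve prime ideals over \<open>P\<close>, and the final clause will give the
  exact index of \<open>PO\<close>.\<close>

lemma has_index_adjoin_list:
  assumes P: "irreducible P" and J: "submodule J" and Pa: "\<And>i. i < s \<Longrightarrow> \<phi> P * a i \<in> J"
  shows "\<exists>m\<le>s. has_index (adjoin_list J a s) J ((card (UNIV :: 'a set) ^ degree P) ^ m) \<and>
    ((\<forall>i<s. a i \<notin> adjoin_list J a i) \<longrightarrow> m = s)"
  using Pa
proof (induction s)
  case 0
  have "add_subgroup J" using J by (simp add: submodule_def)
  then show ?case using has_index_self[of J] by auto
next
  case (Suc s)
  let ?Q = "card (UNIV :: 'a set) ^ degree P" and ?K = "adjoin_list J a s"
  obtain m where m: "m \<le> s" "has_index ?K J (?Q ^ m)" "(\<forall>i<s. a i \<notin> adjoin_list J a i) \<longrightarrow> m = s"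
    using Suc.IH Suc.prems by auto
  have K: "submodule ?K" by (rule adjoin_list_submodule[OF J])
  show ?case
  proof (cases "a s \<in> ?K")
    case True
    then show ?thesis using m adjoin_absorb[OF K True] by (intro exI[of _ m]) auto
  next
    case False
    have "\<phi> P * a s \<in> ?K" using Suc.prems[of s] adjoin_list_superset[of J a s] by auto
    then have idx: "has_index (adjoin ?K (a s)) ?K ?Q" using has_index_adjoin[OF P K _ False] by blast
    have "has_index (adjoin ?K (a s)) J (?Q * ?Q ^ m)"
    proof (rule has_index_mult[OF _ _ _ _ _ idx m(2)])
      show "add_subgroup J" "add_subgroup ?K" "add_subgroup (adjoin ?K (a s))"
        using J K adjoin_submodule[OF K] by (auto simp: submodule_def)
    qed (rule adjoin_list_superset, rule adjoin_superset)
    then show ?thesis using m by (intro exI[of _ "Suc m"]) auto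
  qed
qed

end

section \<open>The trace form at a prime not dividing the discriminant\<close>

locale unramified_prime = function_field \<psi> d
  for \<psi> :: "'a::{finite,field} poly fract \<Rightarrow> 'k::field" and d :: nat +
  fixes P :: "'a poly" and a :: "nat \<Rightarrow> 'k"
  assumes P: "irreducible P" and a: "\<And>i. i < d \<Longrightarrow> a i \<in> \<O>"
    and disc: "\<not> (\<exists>p. ext_disc \<psi> d a = embed (P * p))"
begin

text \<open>The trace matrix pulled back along \<open>embed\<close>, possible because traces of
  elements of \<open>O\<close> are polynomials. The tuple is not assumed to be an integral basis;
  that it is a basis modulo \<open>P\<close> will follow from \<open>not_dvd_disc\<close>.\<close>

definition gram :: "'a poly mat" where
  "gram = mat d d (\<lambda>(i, j). SOME s. tr (a i * a j) = embed s)"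

lemma gram_carrier: "gram \<in> carrier_mat d d"
  by (simp add: gram_def)

lemma tr_gram:
  assumes "i < d" "j < d"
  shows "tr (a i * a j) = embed (gram $$ (i, j))"
proof -
  have "\<exists>s. tr (a i * a j) = embed s" using tr_integral[OF OK_mult[OF a a]] assms by auto
  from someI_ex[OF this] show ?thesis using assms by (simp add: gram_def)
qed

lemma disc_eq: "ext_disc \<psi> d a = embed (det gram)"
proof -
  interpret embed: comm_ring_hom "embed :: 'a poly \<Rightarrow> 'a poly fract"
    by unfold_locales (auto simp: embed_add embed_mult)
  have "mat d d (\<lambda>(i, j). ext_trace \<psi> d (a i * a j)) = map_mat embed gram"
    by (rule eq_matI) (auto simp: tr_gram[unfolded tr_def] gram_def[THEN arg_cong[of _ _ dim_row]]
      gram_def[THEN arg_cong[of _ _ dim_col]])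
  then show ?thesis unfolding ext_disc_def by (simp add: embed.hom_det)
qed

lemma not_dvd_disc: "\<not> P dvd det gram"
  using disc unfolding disc_eq by (auto elim!: dvdE)

lemma disc_nonzero: "det gram \<noteq> 0"
  using not_dvd_disc by auto

text \<open>The trace matrix of the tuple factors as \<open>H * C\<close>, where \<open>C\<close>
  holds the coordinates of the tuple in \<open>B\<close>. Its determinant is nonzero, so
  \<open>H\<close> is invertible, and \<open>H\<close> kills the coordinate vector of
  \<open>y\<close>.\<close>

lemma trace_form_nondegenerate:
  assumes y: "\<And>j. j < d \<Longrightarrow> tr (a j * y) = 0"
  shows "y = 0"
proof -
  define H where "H = mat d d (\<lambda>(j, k). tr (a j * B k))"
  define C where "C = mat d d (\<lambda>(k, i). crd (a i) k)"
  have HC: "H \<in> carrier_mat d d" "C \<in> carrier_mat d d" by (auto simp: H_def C_def)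
  have expand: "tr (a j * z) = (\<Sum>k<d. tr (a j * B k) * crd z k)" for j z
  proof -
    have e: "a j * z = (\<Sum>k<d. \<psi> (crd z k) * (a j * B k))"
      by (subst crd_expand[of z]) (simp add: sum_distrib_left mult.left_commute)
    show ?thesis unfolding e tr_sum tr_scale by (intro sum.cong refl mult.commute)
  qed
  have "mat d d (\<lambda>(i, j). ext_trace \<psi> d (a i * a j)) = H * C"
  proof (rule eq_matI)
    fix i j assume "i < dim_row (H * C)" "j < dim_col (H * C)"
    then have ij: "i < d" "j < d" by (auto simp: H_def C_def)
    have "(H * C) $$ (i, j) = (\<Sum>k<d. tr (a i * B k) * crd (a j) k)"
      using ij by (simp add: H_def C_def scalar_prod_def atLeast0LessThan)
    then show "mat d d (\<lambda>(i, j). ext_trace \<psi> d (a i * a j)) $$ (i, j) = (H * C) $$ (i, j)"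
      using ij expand[of i "a j"] by (simp add: tr_def)
  qed (simp_all add: H_def C_def)
  then have "ext_disc \<psi> d a = det H * det C" unfolding ext_disc_def by (simp add: det_mult[OF HC])
  then have "det H \<noteq> 0" using disc_nonzero disc_eq by auto
  moreover have "H *\<^sub>v vec d (crd y) = 0\<^sub>v d"
  proof (rule eq_vecI)
    fix j assume "j < dim_vec (0\<^sub>v d :: 'a poly fract vec)"
    then have j: "j < d" by simp
    have "(H *\<^sub>v vec d (crd y)) $ j = tr (a j * y)"
      unfolding expand[of j y] using j by (simp add: H_def scalar_prod_def atLeast0LessThan)
    then show "(H *\<^sub>v vec d (crd y)) $ j = 0\<^sub>v d $ j" using y[OF j] j by simp
  qed (simp add: H_def)
  ultimately have v: "vec d (crd y) = 0\<^sub>v d"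
    using det_0_iff_vec_prod_zero_field[OF HC(1)] vec_carrier[of d "crd y"] by blast
  have "crd y k = 0" if "k < d" for k
    using arg_cong[OF v, of "\<lambda>v. vec_index v k"] that by simp
  then show ?thesis using crd_expand[of y] by simp
qed

text \<open>Both sides have the same trace against every \<open>a k\<close>, since
  \<open>gram\<close> times its adjugate is \<open>det gram\<close> times the identity;
  nondegeneracy then makes them equal. The coefficients are polynomials because only the adjugate is
  used, not the inverse.\<close>

lemma cramer:
  assumes y: "y \<in> \<O>" and s: "\<And>j. j < d \<Longrightarrow> tr (a j * y) = embed (s j)"
  shows "\<phi> (det gram) * y = (\<Sum>i<d. \<phi> (\<Sum>j<d. adj_mat gram $$ (i, j) * s j) * a i)"
proof -
  define c where "c i = (\<Sum>j<d. adj_mat gram $$ (i, j) * s j)" for i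
  have "\<phi> (det gram) * y - (\<Sum>i<d. \<phi> (c i) * a i) = 0"
  proof (rule trace_form_nondegenerate)
    fix k assume k: "k < d"
    have "a k * (\<phi> (det gram) * y - (\<Sum>i<d. \<phi> (c i) * a i)) + (\<Sum>i<d. \<psi> (embed (c i)) * (a k * a i))
      = \<psi> (embed (det gram)) * (a k * y)"
      by (simp add: \<phi>_def algebra_simps sum_distrib_left)
    from arg_cong[OF this, of tr]
    have "tr (a k * (\<phi> (det gram) * y - (\<Sum>i<d. \<phi> (c i) * a i)))
        + (\<Sum>i<d. embed (c i) * embed (gram $$ (k, i))) = embed (det gram) * embed (s k)"
      unfolding tr_add tr_sum tr_scale s[OF k] using tr_gram[OF k] by simp
    moreover have "(\<Sum>i<d. embed (c i) * embed (gram $$ (k, i))) = embed (\<Sum>i<d. gram $$ (k, i) * c i)"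
      by (simp add: embed_sum embed_mult mult.commute)
    moreover have "(\<Sum>i<d. gram $$ (k, i) * c i) = det gram * s k"
    proof -
      have "(\<Sum>i<d. gram $$ (k, i) * c i) = (\<Sum>i<d. \<Sum>j<d. gram $$ (k, i) * adj_mat gram $$ (i, j) * s j)"
        unfolding c_def by (simp add: sum_distrib_left mult.assoc)
      also have "\<dots> = (\<Sum>j<d. (\<Sum>i<d. gram $$ (k, i) * adj_mat gram $$ (i, j)) * s j)"
        by (subst sum.swap) (simp add: sum_distrib_right)
      also have "\<dots> = (\<Sum>j<d. (if k = j then det gram else 0) * s j)"
        using k adj_mat_sums(1)[OF gram_carrier] by simp
      also have "\<dots> = (\<Sum>j<d. if k = j then det gram * s j else 0)" by (intro sum.cong) auto
      also have "\<dots> = det gram * s k" using k by simp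
      finally show ?thesis .
    qed
    ultimately show "tr (a k * (\<phi> (det gram) * y - (\<Sum>i<d. \<phi> (c i) * a i))) = 0"
      by (simp add: embed_mult)
  qed
  then show ?thesis unfolding c_def by simp
qed

lemma tr_values:
  assumes "y \<in> \<O>"
  obtains s where "\<And>j. j < d \<Longrightarrow> tr (a j * y) = embed (s j)"
proof -
  have "\<forall>j\<in>{..<d}. \<exists>s. tr (a j * y) = embed s" using tr_integral[OF OK_mult[OF a assms]] by auto
  from bchoice[OF this] show ?thesis using that by auto
qed

text \<open>By Bezout \<open>det gram\<close> is invertible modulo \<open>P\<close>, so it can be
  cancelled.\<close>

lemma multiple_if_disc_multiple:
  assumes y: "y \<in> \<O>" and D: "\<phi> (det gram) * y \<in> multiples P"
  shows "y \<in> multiples P"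
proof -
  obtain u v where uv: "u * det gram + v * P = 1" using irreducible_poly_bezout[OF P not_dvd_disc] .
  have "y = \<phi> (u * det gram + v * P) * y" unfolding uv by simp
  also have "\<dots> = \<phi> u * (\<phi> (det gram) * y) + \<phi> v * (\<phi> P * y)"
    by (simp add: phi_add phi_mult algebra_simps)
  also have "\<dots> \<in> multiples P"
    using ideal_submodule[OF multiples_ideal[of P]] D y unfolding submodule_def
    by (auto intro!: add_subgroup_add)
  finally show ?thesis .
qed

text \<open>This is the reducedness of \<open>O/PO\<close>. If \<open>z\<close> is nilpotent modulo
  \<open>P\<close>, so is each \<open>a j * z\<close>, and its trace is divisible by
  \<open>P\<close>. Cramer's rule then puts a factor \<open>P\<close> into every coefficient of
  \<open>det gram\<close> times \<open>z\<close>.\<close>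

lemma multiples_radical:
  assumes z: "z \<in> \<O>" and zn: "z ^ n \<in> multiples P"
  shows "z \<in> multiples P"
proof -
  from zn obtain y where y: "z ^ n = \<phi> P * y" "y \<in> \<O>" by auto
  have "\<exists>t. tr (a j * z) = embed (P * t)" if j: "j < d" for j
  proof -
    have "(a j * z) ^ n = \<phi> P * (a j ^ n * y)" by (simp add: power_mult_distrib y(1) mult.left_commute)
    then show ?thesis
      using tr_nilpotent_mod[OF P OK_mult[OF a[OF j] z] OK_mult[OF OK_power[OF a[OF j]] y(2)]] by blast
  qed
  then have "\<forall>j\<in>{..<d}. \<exists>t. tr (a j * z) = embed (P * t)" by auto
  from bchoice[OF this] obtain t where t: "\<And>j. j < d \<Longrightarrow> tr (a j * z) = embed (P * t j)" by auto
  have "\<phi> (det gram) * z = (\<Sum>i<d. \<phi> (\<Sum>j<d. adj_mat gram $$ (i, j) * (P * t j)) * a i)"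
    by (rule cramer[OF z t])
  also have "\<dots> = \<phi> P * (\<Sum>i<d. \<phi> (\<Sum>j<d. adj_mat gram $$ (i, j) * t j) * a i)"
    by (simp add: phi_sum phi_mult sum_distrib_left sum_distrib_right algebra_simps)
  also have "\<dots> \<in> multiples P"
    by (intro imageI add_subgroup_sum[OF OK_group] OK_mult phi_in_OK a) auto
  finally show ?thesis by (rule multiple_if_disc_multiple[OF z])
qed

text \<open>Cramer's rule writes \<open>det gram\<close> times \<open>y\<close> through the tuple,
  and \<open>det gram\<close> is invertible modulo \<open>P\<close>. Hence the tuple generates
  \<open>O\<close> modulo \<open>PO\<close>, and so modulo every ideal above it.\<close>

lemma OK_eq_adjoin_list:
  assumes I: "is_ideal \<O> I" and PI: "multiples P \<subseteq> I"
  shows "adjoin_list I a d = \<O>"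
proof (intro equalityI subsetI)
  fix y assume "y \<in> adjoin_list I a d"
  then obtain j c where "j \<in> I" "y = j + (\<Sum>i<d. \<phi> (c i) * a i)" unfolding adjoin_list_iff by blast
  then show "y \<in> \<O>"
    using I unfolding is_ideal_def
    by (auto intro!: add_subgroup_add[OF OK_group] add_subgroup_sum[OF OK_group] OK_mult phi_in_OK a)
next
  fix y assume y: "y \<in> \<O>"
  obtain u v where uv: "u * det gram + v * P = 1" using irreducible_poly_bezout[OF P not_dvd_disc] .
  obtain s where s: "\<And>j. j < d \<Longrightarrow> tr (a j * y) = embed (s j)" using tr_values[OF y] by blast
  define c where "c i = (\<Sum>j<d. adj_mat gram $$ (i, j) * s j)" for i
  have cr: "\<phi> (det gram) * y = (\<Sum>i<d. \<phi> (c i) * a i)" unfolding c_def using y s by (rule cramer)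
  have "y = \<phi> (u * det gram + v * P) * y" unfolding uv by simp
  also have "\<dots> = \<phi> P * (\<phi> v * y) + \<phi> u * (\<phi> (det gram) * y)"
    by (simp add: phi_add phi_mult algebra_simps)
  also have "\<dots> = \<phi> P * (\<phi> v * y) + (\<Sum>i<d. \<phi> (u * c i) * a i)"
    unfolding cr by (simp add: phi_mult sum_distrib_left mult.assoc)
  finally have "y = \<phi> P * (\<phi> v * y) + (\<Sum>i<d. \<phi> (u * c i) * a i)" .
  moreover have "\<phi> P * (\<phi> v * y) \<in> I" using PI OK_mult[OF phi_in_OK y] by blast
  ultimately show "y \<in> adjoin_list I a d"
    unfolding adjoin_list_iff by (intro bexI[of _ "\<phi> P * (\<phi> v * y)"] exI[of _ "\<lambda>i. u * c i"])
qed

text \<open>Taking traces against each \<open>a k\<close> turns the relation into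
  \<open>gram\<close> times \<open>c\<close> being divisible by \<open>P\<close>. Multiplying by the
  adjugate leaves \<open>det gram * c i\<close>, and \<open>P\<close> is prime to
  \<open>det gram\<close>.\<close>

lemma independent_mod:
  assumes m: "(\<Sum>i<d. \<phi> (c i) * a i) \<in> multiples P" and i: "i < d"
  shows "P dvd c i"
proof -
  from m obtain y where y: "(\<Sum>i<d. \<phi> (c i) * a i) = \<phi> P * y" "y \<in> \<O>" by auto
  obtain s where s: "\<And>j. j < d \<Longrightarrow> tr (a j * y) = embed (s j)" using tr_values[OF y(2)] by blast
  have row: "(\<Sum>l<d. gram $$ (k, l) * c l) = P * s k" if k: "k < d" for k
  proof -
    have e: "(\<Sum>l<d. \<psi> (embed (c l)) * (a k * a l)) = \<psi> (embed P) * (a k * y)"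
      using arg_cong[OF y(1), of "\<lambda>z. a k * z"] by (simp add: \<phi>_def sum_distrib_left mult.left_commute)
    have "(\<Sum>l<d. embed (c l) * tr (a k * a l)) = embed P * tr (a k * y)"
      using arg_cong[OF e, of tr] unfolding tr_sum tr_scale .
    then have "(\<Sum>l<d. embed (c l) * embed (gram $$ (k, l))) = embed P * embed (s k)"
      using k by (simp add: tr_gram s)
    then have "embed (\<Sum>l<d. gram $$ (k, l) * c l) = embed (P * s k)"
      by (simp add: embed_sum embed_mult mult.commute)
    then show ?thesis unfolding embed_eq_iff .
  qed
  have "det gram * c i = (\<Sum>l<d. if i = l then det gram * c l else 0)" using i by simp
  also have "\<dots> = (\<Sum>l<d. (if i = l then det gram else 0) * c l)" by (intro sum.cong) auto
  also have "\<dots> = (\<Sum>l<d. (\<Sum>k<d. adj_mat gram $$ (i, k) * gram $$ (k, l)) * c l)"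
    using i adj_mat_sums(2)[OF gram_carrier] by simp
  also have "\<dots> = (\<Sum>k<d. \<Sum>l<d. adj_mat gram $$ (i, k) * gram $$ (k, l) * c l)"
    by (subst sum.swap) (simp add: sum_distrib_right)
  also have "\<dots> = (\<Sum>k<d. adj_mat gram $$ (i, k) * (\<Sum>l<d. gram $$ (k, l) * c l))"
    by (simp add: sum_distrib_left mult.assoc)
  also have "\<dots> = P * (\<Sum>k<d. adj_mat gram $$ (i, k) * s k)"
    by (simp add: row sum_distrib_left mult.left_commute)
  finally have "P dvd det gram * c i" by simp
  then show ?thesis using irreducible_poly_dvd_mult[OF P] not_dvd_disc by blast
qed

lemma index_ideal:
  assumes I: "is_ideal \<O> I" and PI: "multiples P \<subseteq> I"
  shows "\<exists>m\<le>d. has_index \<O> I ((card (UNIV :: 'a set) ^ degree P) ^ m) \<and>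
    ((\<forall>i<d. a i \<notin> adjoin_list I a i) \<longrightarrow> m = d)"
proof -
  have "\<phi> P * a i \<in> I" if "i < d" for i using PI a[OF that] by blast
  then show ?thesis
    using has_index_adjoin_list[OF P ideal_submodule[OF I], of d a] unfolding OK_eq_adjoin_list[OF I PI] by simp
qed

lemma index_multiples: "has_index \<O> (multiples P) (card (UNIV :: 'a set) ^ (d * degree P))"
proof -
  have "a i \<notin> adjoin_list (multiples P) a i" if i: "i < d" for i
  proof
    assume "a i \<in> adjoin_list (multiples P) a i"
    then obtain j c where jc: "j \<in> multiples P" "a i = j + (\<Sum>k<i. \<phi> (c k) * a k)"
      unfolding adjoin_list_iff by blast
    \<comment> \<open>Membership of \<open>a i\<close> becomes a relation modulo \<open>P\<close>
      with coefficient 1 at \<open>i\<close>, against independence.\<close>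
    define e where "e k = (if k < i then - c k else if k = i then 1 else 0)" for k
    have "(\<Sum>k<d. \<phi> (e k) * a k) = (\<Sum>k<Suc i. \<phi> (e k) * a k)"
      using i by (intro sum.mono_neutral_right) (auto simp: e_def)
    also have "\<dots> = a i - (\<Sum>k<i. \<phi> (c k) * a k)"
      by (simp add: e_def phi.hom_uminus sum_negf)
    also have "\<dots> = j" using jc(2) by simp
    finally have "P dvd e i" using jc(1) i by (intro independent_mod) auto
    then show False using P by (simp add: e_def irreducible_def)
  qed
  then show ?thesis
    using index_ideal[OF multiples_ideal subset_refl] by (auto simp: power_mult[symmetric] mult.commute)
qed

text \<open>Since \<open>O/PO\<close> is reduced, a nonzero class \<open>?b\<close> is not nilpotent
  and is avoided by a prime ideal \<open>I\<close> over \<open>P\<close>. The quotient by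
  \<open>I\<close> has \<open>q ^ (m * degree P)\<close> elements with
  \<open>1 \<le> m \<le> d\<close>, so \<open>q ^ N\<close> is a power of that number and Fermat's
  little theorem puts \<open>?b\<close> into \<open>I\<close>.\<close>

lemma power_congruent:
  assumes N: "\<And>m. 1 \<le> m \<Longrightarrow> m \<le> d \<Longrightarrow> m * degree P dvd N" and x: "x \<in> \<O>"
  shows "x ^ (card (UNIV :: 'a set) ^ N) - x \<in> multiples P"
proof (rule ccontr)
  let ?b = "x ^ (card (UNIV :: 'a set) ^ N) - x" and ?q = "card (UNIV :: 'a set)"
  assume b: "?b \<notin> multiples P"
  have bO: "?b \<in> \<O>" by (intro OK_diff OK_power x)
  have "?b ^ n \<notin> multiples P" for n using b multiples_radical[OF bO] by blast
  then obtain I where I: "is_prime_ideal \<O> I" "multiples P \<subseteq> I" "?b \<notin> I"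
    using exists_prime_ideal_avoiding[OF OK_subring multiples_ideal index_multiples bO] by blast
  have I': "is_ideal \<O> I" "add_subgroup I" "1 \<notin> I" using I(1) by (auto simp: is_prime_ideal_def is_ideal_def)
  obtain m where m: "m \<le> d" "has_index \<O> I ((?q ^ degree P) ^ m)"
    using index_ideal[OF I'(1) I(2)] by blast
  \<comment> \<open>Index 1 would make 0 and 1 congruent modulo \<open>I\<close>, which a prime
    ideal excludes.\<close>
  have "m \<noteq> 0"
  proof
    assume "m = 0"
    then obtain t where t: "\<And>x. x \<in> \<O> \<Longrightarrow> x - t \<in> I"
      using m(2) unfolding has_index_def by (auto simp: card_1_singleton_iff)
    have "(1 - t) - (0 - t) \<in> I"
      by (rule add_subgroup_diff[OF I'(2) t t]) (use phi_in_OK[of 0] phi_in_OK[of 1] in simp_all)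
    then show False using I'(3) by simp
  qed
  then have "m * degree P dvd N" using N m(1) by simp
  then obtain k where "N = m * degree P * k" by (rule dvdE)
  then have "?q ^ N = ((?q ^ degree P) ^ m) ^ k" by (simp add: power_mult[symmetric] mult.commute mult.left_commute)
  then have "?b \<in> I" using prime_ideal_power_index_power[OF OK_subring I(1) m(2) x, of k] by simp
  then show False using I(3) by simp
qed

end

section \<open>Square-free moduli\<close>

context function_field
begin

lemma multiples_group: "add_subgroup (multiples r)"
  using multiples_ideal[of r] by (simp add: is_ideal_def)

lemma multiples_unit:
  assumes "is_unit r"
  shows "multiples r = \<O>"
proof
  show "multiples r \<subseteq> \<O>" using multiples_ideal[of r] by (simp add: is_ideal_def)
  from assms obtain s where s: "1 = r * s" by (rule dvdE)
  show "\<O> \<subseteq> multiples r"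
  proof
    fix x assume x: "x \<in> \<O>"
    have "x = \<phi> (r * s) * x" unfolding s[symmetric] by simp
    also have "\<dots> = \<phi> r * (\<phi> s * x)" by (simp add: phi_mult mult.assoc)
    finally show "x \<in> multiples r" using OK_mult[OF phi_in_OK[of s] x] by blast
  qed
qed

lemma multiples_mult: "multiples (r * s) = (*) (\<phi> r) ` multiples s"
  by (simp add: image_image phi_mult mult.assoc)

text \<open>With one irreducible factor split off as \<open>r = P * s\<close>, the tower from
  \<open>rO\<close> through \<open>PO\<close> to \<open>O\<close> has the index of \<open>sO\<close>
  in its lower step, rescaled by \<open>P\<close>.\<close>

lemma index_multiples_poly:
  assumes "r \<noteq> 0"
    and "\<And>P. irreducible P \<Longrightarrow> P dvd r \<Longrightarrow> has_index \<O> (multiples P) (card (UNIV :: 'a set) ^ (d * degree P))"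
  shows "has_index \<O> (multiples r) (card (UNIV :: 'a set) ^ (d * degree r))"
  using assms
proof (induction "degree r" arbitrary: r rule: less_induct)
  case less
  show ?case
  proof (cases "is_unit r")
    case True
    then have "degree r = 0" using less.prems(1) is_unit_iff_degree by blast
    then show ?thesis unfolding multiples_unit[OF True] using has_index_self[OF OK_group] by simp
  next
    case False
    then obtain P where P: "irreducible P" "P dvd r" using exists_irreducible_poly_factor less.prems(1) by blast
    from P(2) obtain s where s: "r = P * s" by (rule dvdE)
    have nz: "P \<noteq> 0" "s \<noteq> 0" using s less.prems(1) by auto
    have deg: "degree r = degree P + degree s" unfolding s using nz by (rule degree_mult_eq)
    have "\<not> is_unit P" using P(1) unfolding irreducible_def by blast
    then have "degree P > 0" using nz(1) is_unit_iff_degree by blast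
    then have lt: "degree s < degree r" using deg by simp
    have "has_index \<O> (multiples s) (card (UNIV :: 'a set) ^ (d * degree s))"
      using less.prems(2) by (intro less.hyps[OF lt nz(2)]) (simp add: s)
    then have idx: "has_index (multiples P) (multiples r) (card (UNIV :: 'a set) ^ (d * degree s))"
      unfolding s multiples_mult using nz(1) by (intro has_index_scale) simp
    have "has_index \<O> (multiples r)
        (card (UNIV :: 'a set) ^ (d * degree P) * card (UNIV :: 'a set) ^ (d * degree s))"
    proof (rule has_index_mult[OF multiples_group multiples_group OK_group _ _ less.prems(2)[OF P] idx])
      show "multiples r \<subseteq> multiples P"
        unfolding s multiples_mult using multiples_ideal[of s] by (auto simp: is_ideal_def)
      show "multiples P \<subseteq> \<O>" using multiples_ideal[of P] by (simp add: is_ideal_def)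
    qed
    then show ?thesis by (simp add: deg distrib_left power_add)
  qed
qed

text \<open>Write \<open>r = P * s\<close>, where \<open>s\<close> is prime to \<open>P\<close> by
  square-freeness. From \<open>x = P z = s y\<close> and \<open>u s + v P = 1\<close> follows
  \<open>x = P s (u z + v y)\<close>.\<close>

lemma mem_multiples_squarefree:
  assumes "squarefree r" and x: "x \<in> \<O>"
    and "\<And>P. irreducible P \<Longrightarrow> P dvd r \<Longrightarrow> x \<in> multiples P"
  shows "x \<in> multiples r"
  using assms(1,3)
proof (induction "degree r" arbitrary: r rule: less_induct)
  case less
  show ?case
  proof (cases "is_unit r")
    case True
    then show ?thesis using multiples_unit x by simp
  next
    case False
    have r0: "r \<noteq> 0" using less.prems(1) by auto
    then obtain P where P: "irreducible P" "P dvd r" using exists_irreducible_poly_factor False by blast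
    from P(2) obtain s where s: "r = P * s" by (rule dvdE)
    have nz: "P \<noteq> 0" "s \<noteq> 0" using s r0 by auto
    have nu: "\<not> is_unit P" using P(1) unfolding irreducible_def by blast
    then have "degree P > 0" using nz(1) is_unit_iff_degree by blast
    then have lt: "degree s < degree r" unfolding s using nz by (simp add: degree_mult_eq)
    have sf: "squarefree s"
      using less.prems(1) unfolding s squarefree_def by (meson dvd_mult)
    have "x \<in> multiples s"
      using less.prems(2) by (intro less.hyps[OF lt sf]) (simp add: s)
    then obtain y where y: "x = \<phi> s * y" "y \<in> \<O>" by auto
    obtain z where z: "x = \<phi> P * z" "z \<in> \<O>" using less.prems(2)[OF P] by auto
    have "\<not> P dvd s"
    proof
      assume "P dvd s"
      then have "P ^ 2 dvd r" unfolding s power2_eq_square by (rule mult_dvd_mono[OF dvd_refl])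
      then show False using less.prems(1) nu unfolding squarefree_def by blast
    qed
    then obtain u v where uv: "u * s + v * P = 1" by (rule irreducible_poly_bezout[OF P(1)])
    have "x = \<phi> (u * s + v * P) * x" unfolding uv by simp
    also have "\<dots> = \<phi> u * \<phi> s * x + \<phi> v * \<phi> P * x" by (simp add: phi_add phi_mult distrib_right)
    also have "\<dots> = \<phi> u * \<phi> s * (\<phi> P * z) + \<phi> v * \<phi> P * (\<phi> s * y)"
      unfolding z(1)[symmetric] y(1)[symmetric] ..
    \<comment> \<open>The sign is absorbed into \<open>- v\<close> so that closure of
      \<open>O\<close> under differences applies.\<close>
    also have "\<dots> = \<phi> r * (\<phi> u * z - \<phi> (- v) * y)"
      unfolding s by (simp add: phi_mult phi.hom_uminus algebra_simps)
    finally have "x = \<phi> r * (\<phi> u * z - \<phi> (- v) * y)" .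
    moreover have "\<phi> u * z - \<phi> (- v) * y \<in> \<O>" by (intro OK_diff OK_mult phi_in_OK z(2) y(2))
    ultimately show ?thesis by (rule image_eqI)
  qed
qed

text \<open>For \<open>g = u v\<close> with non-units, \<open>u\<close> is nonzero modulo
  \<open>g\<close>: otherwise \<open>v\<close> would become invertible in \<open>O\<close>, against
  \<open>OK_phi_unit\<close>. An inverse \<open>b\<close> of \<open>u\<close> would make
  \<open>v\<close> congruent to \<open>v u b = g b\<close>, hence to 0, which is impossible by the
  same argument with the factors exchanged.\<close>

lemma quotient_not_field:
  assumes "reducible_poly g"
  shows "\<not> quot_is_field \<O> (multiples g)"
proof
  assume fld: "quot_is_field \<O> (multiples g)"
  from assms obtain u v where uv: "g = u * v" "\<not> is_unit u" "\<not> is_unit v" and g0: "g \<noteq> 0"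
    unfolding reducible_poly_def irreducible_def by blast
  have nonmem: "\<phi> r \<notin> multiples g" if g: "g = r * s" and s: "\<not> is_unit s" for r s
  proof
    assume "\<phi> r \<in> multiples g"
    then obtain y where y: "\<phi> r = \<phi> (r * s) * y" "y \<in> \<O>" unfolding g by (rule imageE)
    have "r \<noteq> 0" using g0 unfolding g by (rule contrapos_nn) simp
    then have "\<phi> s * y = 1" using y(1) by (simp add: phi_mult mult.assoc)
    then show False using OK_phi_unit[OF y(2)] s by blast
  qed
  have "\<phi> u \<notin> multiples g" using nonmem[OF uv(1,3)] .
  then obtain b where b: "b \<in> \<O>" "\<phi> u * b - 1 \<in> multiples g"
    using fld[unfolded quot_is_field_def, THEN conjunct2, THEN bspec, OF phi_in_OK[of u]] by blast
  have "\<phi> g * b \<in> multiples g" using b(1) by (rule imageI)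
  moreover have "\<phi> v * (\<phi> u * b - 1) \<in> multiples g"
    using multiples_ideal[of g] b(2) phi_in_OK unfolding is_ideal_def by blast
  ultimately have "\<phi> g * b - \<phi> v * (\<phi> u * b - 1) \<in> multiples g"
    by (rule add_subgroup_diff[OF multiples_group])
  then have "\<phi> v \<in> multiples g" unfolding uv(1) by (simp add: phi_mult algebra_simps)
  moreover have "g = v * u" unfolding uv(1) by (rule mult.commute)
  ultimately show False using nonmem[OF _ uv(2), of v] by simp
qed

end

theorem theorem5p3:
  fixes g :: "'a::{finite,field} poly"
    and \<psi> :: "'a poly fract \<Rightarrow> 'k::field"
    and d :: nat
  assumes "d \<ge> 1"
    and "rigid_carmichael_poly d g"
    and "is_field_hom \<psi>"
    and "ext_degree \<psi> d"
    and "separable_ext \<psi>"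
    and "disc_ideal_coprime \<psi> d g"
  shows "carmichael_in \<psi> (\<psi> (embed g))"
proof -
  interpret function_field \<psi> d using assms(3,4) by unfold_locales
  let ?q = "card (UNIV :: 'a set)"
  have g: "reducible_poly g" "squarefree g"
    and rigid: "\<And>P i. irreducible P \<Longrightarrow> P dvd g \<Longrightarrow> 1 \<le> i \<Longrightarrow> i \<le> d \<Longrightarrow> i * degree P dvd d * degree g"
    using assms(2) unfolding rigid_carmichael_poly_def by blast+
  \<comment> \<open>The tuple may change with \<open>P\<close>, so each irreducible factor gets its
    own instance of the locale.\<close>
  have unram: "\<exists>a. unramified_prime \<psi> d P a" if P: "irreducible P" "P dvd g" for P
  proof -
    obtain a where "\<forall>i<d. a i \<in> \<O>" "\<not> (\<exists>p. ext_disc \<psi> d a = embed (P * p))"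
      using assms(6) P unfolding disc_ideal_coprime_def by blast
    then have "unramified_prime \<psi> d P a" using P(1) by unfold_locales auto
    then show ?thesis by (intro exI[of _ a])
  qed
  have idx: "has_index \<O> (multiples g) (?q ^ (d * degree g))"
  proof (rule index_multiples_poly)
    show "g \<noteq> 0" using g(1) by (simp add: reducible_poly_def)
    show "has_index \<O> (multiples P) (?q ^ (d * degree P))" if "irreducible P" "P dvd g" for P
      using unram[OF that] unramified_prime.index_multiples by blast
  qed
  have pow: "x ^ (?q ^ (d * degree g)) - x \<in> multiples g" if x: "x \<in> \<O>" for x
  proof (rule mem_multiples_squarefree[OF g(2)])
    show "x ^ (?q ^ (d * degree g)) - x \<in> \<O>" by (intro OK_diff OK_power x)
    show "x ^ (?q ^ (d * degree g)) - x \<in> multiples P" if Pg: "irreducible P" "P dvd g" for P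
    proof -
      obtain a where "unramified_prime \<psi> d P a" using unram[OF Pg] by blast
      then interpret unramified_prime \<psi> d P a .
      \<comment> \<open>Rigidity enters here, with \<open>N\<close> equal to
        \<open>d * degree g\<close>, the exponent of \<open>?q\<close> in
        \<open>|O/gO|\<close>.\<close>
      show ?thesis using rigid[OF Pg] x by (rule power_congruent)
    qed
  qed
  have "carmichael_quot \<O> (multiples g)"
    unfolding carmichael_quot_def cosets_card_eq_index(2)[OF multiples_group idx]
    using cosets_card_eq_index(1)[OF multiples_group idx] quotient_not_field[OF g(1)] pow by blast
  moreover have "{\<psi> (embed g) * y | y. y \<in> \<O>} = multiples g" by (auto simp: \<phi>_def)
  ultimately show ?thesis
    unfolding carmichael_in_def using phi_in_OK[of g] by (simp add: \<phi>_def)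
qed

end
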